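(* Let $r\in[1,+\infty)$ be a non-integer, and let $\nu$ be a probability density function on $\mathbb{R}$ (with respect to Lebesgue measure) such that: (a) $\int_{\mathbb{R}}|x|^r\nu(x)\,dx<\infty$; (b) $\nu$ is positive and $\lfloor r\rfloor+1$ times continuously differentiable on $\mathbb{R}$, and $\sup_{t\in\mathbb{R}}\frac{|\nu^{(j)}(t)|}{\nu(t)}<\infty$ for $j=1,\ldots,\lfloor r\rfloor+1$; (c) for every $x_0\in\mathbb{R}$ there exist a neighborhood $V_{x_0}$ of $x_0$ and a non-negative measurable function $q_{x_0}$ on $\mathbb{R}$ such that $\int_{\mathbb{R}}(1+|y|)^r q_{x_0}(y)\,dy<\infty$ and $\nu(y+v)\le q_{x_0}(y)$ for all $y\in\mathbb{R}$ and all $v\in V_{x_0}$. For $\alpha\in(-1,1)$ let $\pi_\alpha$ be the invariant probability measure of the autoregressive Markov chain $X_n=\alpha X_{n-1}+\vartheta_n$ ($n\ge1$), where $(\vartheta_n)_{n\ge1}$ are i.i.d. real random variables with density $\nu$, independent of the real random variable $X_0$. Then there exists $\beta=\beta(r)\in(0,1)$ such that the map $\alpha\mapsto\pi_\alpha$ is $\lfloor r\rfloor$ times continuously differentiable from $(-1,1)$ to the dual space $\mathcal{B}_\beta'$ of $\mathcal{B}_\beta$. In particular, for all $\alpha\in(-1,1)$ there exist $\lfloor r\rfloor$ signed measures $\mu_{\alpha,1},\ldots,\mu_{\alpha,\lfloor r\rfloor}$ on $\mathbb{R}$ such that, for every Borel set $A\subset\mathbb{R}$, $$\pi_{\alpha+\varepsilon}(A)=\pi_\alpha(A)+\sum_{j=1}^{\lfloor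 r\rfloor}\frac{\varepsilon^j}{j!}\,\mu_{\alpha,j}(A)+\varepsilon^{\lfloor r\rfloor}R_\varepsilon(A),\qquad\text{with }\ \lim_{\varepsilon\to0}\ \sup_{A}|R_\varepsilon(A)|=0,$$ the supremum being over all Borel sets $A\subset\mathbb{R}$.
   Context: $\lfloor\cdot\rfloor$ is the integer part. Put $V(x):=(1+|x|)^r$ for $x\in\mathbb{R}$. For $\beta\in[0,1]$, $\mathcal{B}_\beta$ is the Banach space of measurable functions $f:\mathbb{R}\to\mathbb{C}$ with $\|f\|_\beta:=\sup_{x\in\mathbb{R}}V(x)^{-\beta}|f(x)|<\infty$; $\mathcal{B}_\beta'$ is its topological dual with the dual norm, and $\pi_\alpha$ is viewed as the element $f\mapsto\pi_\alpha(f)=\int f\,d\pi_\alpha$ of $\mathcal{B}_\beta'$. The chain has transition kernel $P_\alpha(x,A)=\int_{\mathbb{R}}1_A(y)\,\nu(y-\alpha x)\,dy$. For each $\alpha\in(-1,1)$ it is known to be $V$-geometrically ergodic: it has a unique invariant probability measure $\pi_\alpha$, $\pi_\alpha(V)<\infty$, and there are $c>0$, $\kappa\in(0,1)$ with $\sup_{|f|\le V}|P_\alpha^nf(x)-\pi_\alpha(f)|\le c\,\kappa^nV(x)$ for all $x\in\mathbb{R}$ and $n$. *)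

theory Defs
  imports "HOL-Probability.Probability"
begin

section \<open>Weighted spaces and their duals\<close>

text \<open>
  The exponent \<open>\<beta>\<close> is existentially quantified in the theorem, so the Banach space
  \<open>B\<^sub>\<beta>\<close> and its dual cannot be types; both are rendered as carriers with explicit norms.
\<close>

definition weight :: "real \<Rightarrow> real \<Rightarrow> real" where
  "weight r x = (1 + \<bar>x\<bar>) powr r"

definition wspace :: "real \<Rightarrow> real \<Rightarrow> (real \<Rightarrow> complex) set" where
  "wspace r \<beta> = {f \<in> borel_measurable borel.
     bdd_above (range (\<lambda>x. weight r x powr (- \<beta>) * cmod (f x)))}"

definition wnorm :: "real \<Rightarrow> real \<Rightarrow> (real \<Rightarrow> complex) \<Rightarrow> real" where
  "wnorm r \<beta> f = (SUP x. weight r x powr (- \<beta>) * cmod (f x))"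

text \<open>
  Functionals are total functions on \<^typ>\<open>real \<Rightarrow> complex\<close>; only their values on
  \<^const>\<open>wspace\<close> matter, and no convention is imposed elsewhere.
\<close>

definition wdual :: "real \<Rightarrow> real \<Rightarrow> ((real \<Rightarrow> complex) \<Rightarrow> complex) set" where
  "wdual r \<beta> = {\<phi>.
     (\<forall>f\<in>wspace r \<beta>. \<forall>g\<in>wspace r \<beta>. \<phi> (\<lambda>x. f x + g x) = \<phi> f + \<phi> g) \<and>
     (\<forall>c. \<forall>f\<in>wspace r \<beta>. \<phi> (\<lambda>x. c * f x) = c * \<phi> f) \<and>
     (\<exists>C. \<forall>f\<in>wspace r \<beta>. cmod (\<phi> f) \<le> C * wnorm r \<beta> f)}"

definition wdual_norm :: "real \<Rightarrow> real \<Rightarrow> ((real \<Rightarrow> complex) \<Rightarrow> complex) \<Rightarrow> real" where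
  "wdual_norm r \<beta> \<phi> = (SUP f\<in>{f \<in> wspace r \<beta>. wnorm r \<beta> f \<le> 1}. cmod (\<phi> f))"

definition wdual_continuous_at ::
    "real \<Rightarrow> real \<Rightarrow> (real \<Rightarrow> (real \<Rightarrow> complex) \<Rightarrow> complex) \<Rightarrow> real \<Rightarrow> bool" where
  "wdual_continuous_at r \<beta> F a \<longleftrightarrow>
     ((\<lambda>h. wdual_norm r \<beta> (\<lambda>f. F (a + h) f - F a f)) \<longlongrightarrow> 0) (at 0)"

definition wdual_has_derivative_at ::
    "real \<Rightarrow> real \<Rightarrow> (real \<Rightarrow> (real \<Rightarrow> complex) \<Rightarrow> complex) \<Rightarrow>
     ((real \<Rightarrow> complex) \<Rightarrow> complex) \<Rightarrow> real \<Rightarrow> bool" where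
  "wdual_has_derivative_at r \<beta> F D a \<longleftrightarrow>
     ((\<lambda>h. wdual_norm r \<beta> (\<lambda>f. (F (a + h) f - F a f) / complex_of_real h - D f)) \<longlongrightarrow> 0) (at 0)"

text \<open>
  \<open>F\<close> is \<open>k\<close> times continuously differentiable from the open set \<open>S\<close> into the dual;
  \<open>G j\<close> is the \<open>j\<close>-th derivative.
\<close>

definition wdual_Ck ::
    "real \<Rightarrow> real \<Rightarrow> nat \<Rightarrow> real set \<Rightarrow> (real \<Rightarrow> (real \<Rightarrow> complex) \<Rightarrow> complex) \<Rightarrow> bool" where
  "wdual_Ck r \<beta> k S F \<longleftrightarrow> (\<exists>G. G 0 = F \<and>
     (\<forall>j\<le>k. \<forall>a\<in>S. G j a \<in> wdual r \<beta>) \<and>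
     (\<forall>j<k. \<forall>a\<in>S. wdual_has_derivative_at r \<beta> (G j) (G (Suc j) a) a) \<and>
     (\<forall>a\<in>S. wdual_continuous_at r \<beta> (G k) a))"


section \<open>Densities, the autoregressive kernel and signed measures\<close>

definition Ck_real :: "nat \<Rightarrow> (real \<Rightarrow> real) \<Rightarrow> bool" where
  "Ck_real k g \<longleftrightarrow>
     (\<forall>j<k. \<forall>t. (deriv ^^ j) g differentiable (at t)) \<and> continuous_on UNIV ((deriv ^^ k) g)"

definition prob_density :: "(real \<Rightarrow> real) \<Rightarrow> bool" where
  "prob_density \<nu> \<longleftrightarrow> (\<forall>x. 0 \<le> \<nu> x) \<and> has_bochner_integral lborel \<nu> 1"

text \<open>The law of \<open>\<alpha> * x + \<theta>\<close> when \<open>\<theta>\<close> has density \<open>\<nu>\<close>.\<close>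

definition ar_kernel :: "(real \<Rightarrow> real) \<Rightarrow> real \<Rightarrow> real \<Rightarrow> real measure" where
  "ar_kernel \<nu> \<alpha> x = density lborel (\<lambda>y. ennreal (\<nu> (y - \<alpha> * x)))"

definition ar_invariant :: "(real \<Rightarrow> real) \<Rightarrow> real \<Rightarrow> real measure \<Rightarrow> bool" where
  "ar_invariant \<nu> \<alpha> \<pi> \<longleftrightarrow> prob_space \<pi> \<and> sets \<pi> = sets borel \<and>
     (\<forall>A\<in>sets borel. emeasure \<pi> A = (\<integral>\<^sup>+x. emeasure (ar_kernel \<nu> \<alpha> x) A \<partial>\<pi>))"

text \<open>Real-valued, hence finite, signed measures; values on non-measurable sets are irrelevant.\<close>

definition signed_measure :: "'a measure \<Rightarrow> ('a set \<Rightarrow> real) \<Rightarrow> bool" where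
  "signed_measure M \<mu> \<longleftrightarrow> \<mu> {} = 0 \<and>
     (\<forall>A :: nat \<Rightarrow> 'a set. range A \<subseteq> sets M \<and> disjoint_family A \<longrightarrow>
        (\<lambda>i. \<mu> (A i)) sums \<mu> (\<Union>i. A i))"

end

theory Submission
  imports Defs
begin

text \<open>
  The stationary law is that of \<open>\<theta> + W(\<alpha>)\<close> with \<open>\<theta>\<close> of density \<open>\<nu>\<close> and
  \<open>W(\<alpha>) = \<Sum>k. \<alpha>^(k+1) \<omega>\<^sub>k\<close> an independent random power series, so
  \<open>\<pi>\<^sub>\<alpha>(f) = E \<Psi>(W(\<alpha>))\<close> with \<open>\<Psi>(w) = \<integral> f(y) \<nu>(y - w) dy\<close>. The derivatives of \<open>\<Psi>\<close> fall on
  \<open>\<nu>\<close>, and \<open>|\<nu>^(m)| \<le> C \<nu>\<close> gives \<open>|\<Psi>^(m)(w)| \<le> const * (1 + |w|)^(r - \<lfloor>r\<rfloor>)\<close> whenever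
  \<open>|f(y)| \<le> (1 + |y|)^(r - \<lfloor>r\<rfloor>)\<close>,
  i.e. \<open>\<beta> = (r - \<lfloor>r\<rfloor>) / r\<close>. By the chain rule the \<open>j\<close>-th derivative in \<open>\<alpha>\<close> of \<open>\<Psi>(W(\<alpha>))\<close> is a sum of
  products of one \<open>\<Psi>^(m)(W)\<close> and \<open>m \<le> j\<close> derivatives of \<open>W\<close>; it is of order
  \<open>(r - \<lfloor>r\<rfloor>) + j \<le> r\<close> in the noise, hence dominated by the finite moment of order \<open>r\<close>. The bound
  on \<open>\<nu>^(\<lfloor>r\<rfloor>+1)\<close> makes \<open>\<Psi>^(m)\<close> Lipschitz uniformly in \<open>f\<close>, which turns pointwise
  differentiability into differentiability in the dual norm.
\<close>

section \<open>Dominated differentiation under the integral\<close>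

text \<open>The obstacle is that the moments are used up exactly. A path is measured by one number
  \<open>M = path_bound r b \<omega>\<close> with \<open>M powr r\<close> integrable. Each
  derivative of \<open>W\<close> is at most linear in \<open>M\<close>, whatever its order, so
  \<open>N\<close> of them next to the weight of exponent \<open>\<delta>\<close> already cost
  \<open>M powr r\<close>. The Lipschitz estimate for increments of a top-order term costs one power
  more and cannot be integrated; it is combined with the integrable bound by a minimum. All
  estimates are linear in a bound \<open>K\<close> on the test function, with majorants chosen
  before it. Calculus for each single \<open>f\<close> then suffices, and uniformity enters only
  through the modulus of continuity of the derivatives. The representation by the series is obtained
  by comparing characteristic functions: the recursion contracts their argument to 0, where they
  agree.\<close>

lemma tendsto_integral_dominated_at:
  fixes s :: "real \<Rightarrow> 'a \<Rightarrow> 'b::{banach, second_countable_topology}"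
  assumes "f \<in> borel_measurable M"
    and "eventually (\<lambda>t. s t \<in> borel_measurable M) (at a)"
    and "integrable M w"
    and "AE x in M. ((\<lambda>t. s t x) \<longlongrightarrow> f x) (at a)"
    and "eventually (\<lambda>t. AE x in M. norm (s t x) \<le> w x) (at a)"
  shows "((\<lambda>t. \<integral>x. s t x \<partial>M) \<longlongrightarrow> (\<integral>x. f x \<partial>M)) (at a)"
  unfolding tendsto_at_iff_sequentially comp_def
proof (intro allI impI)
  fix X :: "nat \<Rightarrow> real" assume X: "\<forall>i. X i \<in> UNIV - {a}" "X \<longlonglongrightarrow> a"
  then have lim: "filterlim X (at a) sequentially"
    by (auto simp: filterlim_at)
  have "eventually (\<lambda>t. s t \<in> borel_measurable M \<and> (AE x in M. norm (s t x) \<le> w x)) (at a)"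
    using assms(2,5) by eventually_elim simp
  from filterlim_iff[THEN iffD1, OF lim, rule_format, OF this]
  obtain N where N: "\<And>n. N \<le> n \<Longrightarrow> s (X n) \<in> borel_measurable M"
      "\<And>n. N \<le> n \<Longrightarrow> AE x in M. norm (s (X n) x) \<le> w x"
    by (auto simp: eventually_sequentially)
  show "(\<lambda>n. \<integral>x. s (X n) x \<partial>M) \<longlonglongrightarrow> (\<integral>x. f x \<partial>M)"
  \<comment> \<open>Measurability and domination hold only near \<open>a\<close>, hence only from
    index \<open>N\<close> on; the first \<open>N\<close> terms are dropped.\<close>
  proof (rule LIMSEQ_offset, rule integral_dominated_convergence[where w = w])
    show "AE x in M. (\<lambda>n. s (X (n + N)) x) \<longlonglongrightarrow> f x"
      using assms(4)
    proof eventually_elim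
      case (elim x)
      then have "(\<lambda>n. s (X n) x) \<longlonglongrightarrow> f x"
        by (rule filterlim_compose[OF _ lim])
      then show ?case by (rule LIMSEQ_ignore_initial_segment)
    qed
  qed (use assms N in auto)
qed

lemma has_vector_derivative_iff_quotient:
  fixes f :: "real \<Rightarrow> 'b::real_normed_vector"
  shows "(f has_vector_derivative D) (at a) \<longleftrightarrow>
    ((\<lambda>t. (1 / (t - a)) *\<^sub>R (f t - f a)) \<longlongrightarrow> D) (at a)"
proof -
  have eq: "eventually (\<lambda>t. norm ((f t - f a) - (t - a) *\<^sub>R D) / norm (t - a) =
      norm ((1 / (t - a)) *\<^sub>R (f t - f a) - D)) (at a)"
    unfolding eventually_at_filter
  proof (intro always_eventually allI impI)
    fix t assume "t \<noteq> a"
    then have "(1 / (t - a)) *\<^sub>R (f t - f a) - D = (1 / (t - a)) *\<^sub>R ((f t - f a) - (t - a) *\<^sub>R D)"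
      by (simp add: scaleR_diff_right)
    then show "norm ((f t - f a) - (t - a) *\<^sub>R D) / norm (t - a) =
      norm ((1 / (t - a)) *\<^sub>R (f t - f a) - D)"
      by simp
  qed
  have "(f has_vector_derivative D) (at a) \<longleftrightarrow>
     ((\<lambda>t. norm ((f t - f a) - (t - a) *\<^sub>R D) / norm (t - a)) \<longlongrightarrow> 0) (at a)"
    by (simp add: has_vector_derivative_def has_derivative_iff_norm bounded_linear_scaleR_left)
  also have "\<dots> \<longleftrightarrow> ((\<lambda>t. norm ((1 / (t - a)) *\<^sub>R (f t - f a) - D)) \<longlongrightarrow> 0) (at a)"
    by (rule tendsto_cong[OF eq])
  finally show ?thesis
    by (simp only: tendsto_norm_zero_iff LIM_zero_iff)
qed

lemma vector_derivative_bound: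
  fixes f :: "real \<Rightarrow> 'b::real_normed_vector"
  assumes "\<And>t. t \<in> closed_segment a b \<Longrightarrow> (f has_vector_derivative f' t) (at t)"
    and "\<And>t. t \<in> closed_segment a b \<Longrightarrow> norm (f' t) \<le> B"
  shows "norm (f b - f a) \<le> B * \<bar>b - a\<bar>"
proof -
  have "norm (f b - f a) \<le> B * norm (b - a)"
  proof (rule differentiable_bound[where f' = "\<lambda>t h. h *\<^sub>R f' t" and S = "closed_segment a b"])
    show "(f has_derivative (\<lambda>h. h *\<^sub>R f' t)) (at t within closed_segment a b)"
      if "t \<in> closed_segment a b" for t
      using assms(1)[OF that] by (auto simp: has_vector_derivative_def intro: has_derivative_at_withinI)
    show "onorm (\<lambda>h. h *\<^sub>R f' t) \<le> B" if "t \<in> closed_segment a b" for t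
      by (rule onorm_le) (use assms(2)[OF that] in \<open>simp add: mult.commute[of B] mult_left_mono\<close>)
  qed auto
  then show ?thesis by (simp add: real_norm_def)
qed

text \<open>A bound on the derivative passes to the difference quotients by the mean value
  inequality, so dominated convergence applies to them. The quantifier over \<open>t\<close> stands
  inside \<open>AE\<close> because one null set has to serve for the whole interval.\<close>

lemma has_vector_derivative_integral_dominated:
  fixes F :: "real \<Rightarrow> 'a \<Rightarrow> 'b::{banach, second_countable_topology}"
  assumes e: "0 < e"
    and int: "\<And>t. \<bar>t - a\<bar> < e \<Longrightarrow> integrable M (F t)"
    and meas: "F' a \<in> borel_measurable M"
    and der: "AE x in M. \<forall>t. \<bar>t - a\<bar> < e \<longrightarrow>
        ((\<lambda>t. F t x) has_vector_derivative F' t x) (at t) \<and> norm (F' t x) \<le> w x"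
    and w: "integrable M w"
  shows "((\<lambda>t. \<integral>x. F t x \<partial>M) has_vector_derivative (\<integral>x. F' a x \<partial>M)) (at a)"
  unfolding has_vector_derivative_iff_quotient
proof -
  have near: "eventually (\<lambda>t. \<bar>t - a\<bar> < e \<and> t \<noteq> a) (at a)"
    using e by (auto simp: eventually_at dist_real_def)
  have "((\<lambda>t. \<integral>x. (1 / (t - a)) *\<^sub>R (F t x - F a x) \<partial>M) \<longlongrightarrow> (\<integral>x. F' a x \<partial>M)) (at a)"
  proof (rule tendsto_integral_dominated_at[where w = w])
    show "eventually (\<lambda>t. (\<lambda>x. (1 / (t - a)) *\<^sub>R (F t x - F a x)) \<in> borel_measurable M) (at a)"
      using near
    proof eventually_elim
      case (elim t)
      then have "F t \<in> borel_measurable M" "F a \<in> borel_measurable M"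
        using int[of t] int[of a] e by auto
      then show ?case by measurable
    qed
    show "AE x in M. ((\<lambda>t. (1 / (t - a)) *\<^sub>R (F t x - F a x)) \<longlongrightarrow> F' a x) (at a)"
      using der
    proof eventually_elim
      case (elim x)
      then have "((\<lambda>t. F t x) has_vector_derivative F' a x) (at a)"
        using e by auto
      then show ?case by (simp add: has_vector_derivative_iff_quotient)
    qed
    show "eventually (\<lambda>t. AE x in M. norm ((1 / (t - a)) *\<^sub>R (F t x - F a x)) \<le> w x) (at a)"
      using near
    proof eventually_elim
      case t: (elim t)
      show ?case using der
      proof eventually_elim
        case (elim x)
        have seg: "\<bar>u - a\<bar> < e" if "u \<in> closed_segment a t" for u
          using that t by (auto simp: closed_segment_eq_real_ivl split: if_splits)
        have "norm (F t x - F a x) \<le> w x * \<bar>t - a\<bar>"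
          by (rule vector_derivative_bound[where f = "\<lambda>t. F t x" and f' = "\<lambda>t. F' t x"])
            (use elim seg in auto)
        then show ?case
          using t by (simp add: pos_divide_le_eq del: scaleR_right_diff_distrib scaleR_diff_right)
      qed
    qed
  qed (use meas w in auto)
  also have "?this \<longleftrightarrow> ((\<lambda>t. (1 / (t - a)) *\<^sub>R ((\<integral>x. F t x \<partial>M) - (\<integral>x. F a x \<partial>M))) \<longlongrightarrow>
      (\<integral>x. F' a x \<partial>M)) (at a)"
  proof (rule tendsto_cong, use near in eventually_elim)
    case (elim t)
    then have "integrable M (F t)" "integrable M (F a)"
      using int[of t] int[of a] e by auto
    then show ?case by simp
  qed
  finally show "((\<lambda>t. (1 / (t - a)) *\<^sub>R ((\<integral>x. F t x \<partial>M) - (\<integral>x. F a x \<partial>M))) \<longlongrightarrow>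
      (\<integral>x. F' a x \<partial>M)) (at a)" .
qed

section \<open>Smoothing by the noise density\<close>

text \<open>Submultiplicativity of the weight: it separates the noise variable from the shift under
  an integral.\<close>

lemma powr_one_plus_abs_add:
  fixes x y d :: real
  assumes "0 \<le> d"
  shows "(1 + \<bar>x + y\<bar>) powr d \<le> (1 + \<bar>x\<bar>) powr d * (1 + \<bar>y\<bar>) powr d"
proof -
  have "1 + \<bar>x + y\<bar> \<le> (1 + \<bar>x\<bar>) * (1 + \<bar>y\<bar>)"
    by (simp add: algebra_simps abs_mult[symmetric])
  then have "(1 + \<bar>x + y\<bar>) powr d \<le> ((1 + \<bar>x\<bar>) * (1 + \<bar>y\<bar>)) powr d"
    using assms by (intro powr_mono2) auto
  then show ?thesis by (simp add: powr_mult)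
qed

text \<open>With exponent at most 1 the weight grows at most linearly, so total mass 1 and the
  moment of order \<open>r\<close> together make it integrable against \<open>\<nu>\<close>.\<close>

lemma powr_one_plus_abs_le:
  fixes x :: real
  assumes "0 \<le> d" "d \<le> 1" "1 \<le> r"
  shows "(1 + \<bar>x\<bar>) powr d \<le> 2 + \<bar>x\<bar> powr r"
proof -
  have "(1 + \<bar>x\<bar>) powr d \<le> (1 + \<bar>x\<bar>) powr 1"
    using assms by (intro powr_mono) auto
  moreover have "\<bar>x\<bar> \<le> 1 + \<bar>x\<bar> powr r"
  proof (cases "\<bar>x\<bar> \<le> 1")
    case False
    then have "\<bar>x\<bar> powr 1 \<le> \<bar>x\<bar> powr r" using assms by (intro powr_mono) auto
    then show ?thesis using False by simp
  qed (simp add: add_increasing2)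
  ultimately show ?thesis by simp
qed

text \<open>A Harnack inequality: the logarithm of \<open>g\<close> has derivative at most
  \<open>C\<close> in modulus, hence is \<open>C\<close>-Lipschitz. Nearby translates of the density
  are therefore comparable, which supplies the majorant for differentiating in the
  translation.\<close>

lemma log_derivative_bound_shift:
  fixes g :: "real \<Rightarrow> real"
  assumes pos: "\<And>t. 0 < g t" and diff: "\<And>t. g differentiable (at t)"
    and bound: "\<And>t. \<bar>deriv g t\<bar> \<le> C * g t"
  shows "g (t + s) \<le> exp (C * \<bar>s\<bar>) * g t"
proof -
  have "norm (ln (g (t + s)) - ln (g t)) \<le> C * \<bar>(t + s) - t\<bar>"
  proof (rule vector_derivative_bound[where f' = "\<lambda>u. deriv g u / g u"])
    fix u
    have "(g has_real_derivative deriv g u) (at u)"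
      using diff[of u] by (simp add: DERIV_deriv_iff_real_differentiable)
    from DERIV_chain2[OF DERIV_ln_divide[OF pos] this]
    show "((\<lambda>u. ln (g u)) has_vector_derivative deriv g u / g u) (at u)"
      by (simp add: has_real_derivative_iff_has_vector_derivative)
    show "norm (deriv g u / g u) \<le> C"
      using bound[of u] pos[of u] by (simp add: divide_le_eq)
  qed
  then have "ln (g (t + s)) \<le> C * \<bar>s\<bar> + ln (g t)" by simp
  then have "exp (ln (g (t + s))) \<le> exp (C * \<bar>s\<bar> + ln (g t))" by simp
  then show ?thesis using pos by (simp add: exp_add)
qed

lemma wspace_bound:
  assumes "f \<in> wspace r \<beta>"
  shows "cmod (f x) \<le> wnorm r \<beta> f * (1 + \<bar>x\<bar>) powr (r * \<beta>)"
proof -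
  have "weight r x powr (- \<beta>) * cmod (f x) \<le> wnorm r \<beta> f"
    unfolding wnorm_def using assms by (intro cSUP_upper) (auto simp: wspace_def)
  moreover have "weight r x powr (- \<beta>) = 1 / (1 + \<bar>x\<bar>) powr (r * \<beta>)"
    by (simp add: weight_def powr_powr powr_minus_divide)
  moreover have "0 < (1 + \<bar>x\<bar>) powr (r * \<beta>)" by simp
  ultimately show ?thesis by (simp add: divide_le_eq)
qed

lemma wspace_measurable: "f \<in> wspace r \<beta> \<Longrightarrow> f \<in> borel_measurable borel"
  by (simp add: wspace_def)

text \<open>\<open>N\<close> is the integer part of \<open>r\<close>. That \<open>r\<close> is not
  an integer is expressed by the strictness of \<open>N_less\<close>, which makes the weight
  exponent \<open>\<delta>\<close> positive.\<close>

locale smooth_noise =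
  fixes r :: real and N :: nat and \<nu> :: "real \<Rightarrow> real"
  assumes N_pos: "1 \<le> N" and N_less: "real N < r" and less_N: "r < real N + 1"
    and density: "prob_density \<nu>"
    and moment: "integrable lborel (\<lambda>x. \<bar>x\<bar> powr r * \<nu> x)"
    and pos: "\<And>t. 0 < \<nu> t"
    and smooth: "Ck_real (N + 1) \<nu>"
    and log_bdd: "\<And>j. j \<in> {1..N + 1} \<Longrightarrow> bdd_above (range (\<lambda>t. \<bar>(deriv ^^ j) \<nu> t\<bar> / \<nu> t))"
begin

definition \<delta> :: real where "\<delta> = r - real N"

lemma r_ge_1: "1 \<le> r" using N_pos N_less by linarith

lemma \<delta>_bounds: "0 < \<delta>" "\<delta> < 1" using N_less less_N by (auto simp: \<delta>_def)

text \<open>One constant for all orders, order 0 included, so that \<open>psi\<close> and all its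
  derivatives obey the same bound.\<close>

lemma ex_bound: "\<exists>C. 0 \<le> C \<and> (\<forall>j\<le>N + 1. \<forall>t. \<bar>(deriv ^^ j) \<nu> t\<bar> \<le> C * \<nu> t)"
proof -
  have "\<exists>c. \<forall>t. \<bar>(deriv ^^ j) \<nu> t\<bar> \<le> c * \<nu> t" if "j \<le> N + 1" for j
  proof (cases "j = 0")
    case True
    then show ?thesis using pos less_imp_le by (intro exI[of _ 1]) (auto simp: abs_of_pos)
  next
    case False
    then have "j \<in> {1..N + 1}" using that by auto
    from log_bdd[OF this] obtain c where "\<And>t. \<bar>(deriv ^^ j) \<nu> t\<bar> / \<nu> t \<le> c"
      by (auto simp: bdd_above_def)
    then show ?thesis using pos by (intro exI[of _ c]) (simp add: divide_le_eq)
  qed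
  then obtain c where c: "\<And>j t. j \<le> N + 1 \<Longrightarrow> \<bar>(deriv ^^ j) \<nu> t\<bar> \<le> c j * \<nu> t"
    by metis
  have "\<bar>(deriv ^^ j) \<nu> t\<bar> \<le> (\<Sum>i\<le>N+1. \<bar>c i\<bar>) * \<nu> t" if "j \<le> N + 1" for j t
  proof -
    have "c j \<le> \<bar>c j\<bar>" by simp
    also have "\<dots> \<le> (\<Sum>i\<le>N+1. \<bar>c i\<bar>)" using that by (intro member_le_sum) auto
    finally have "c j * \<nu> t \<le> (\<Sum>i\<le>N+1. \<bar>c i\<bar>) * \<nu> t"
      using pos[of t] by (intro mult_right_mono) auto
    with c[OF that, of t] show ?thesis by linarith
  qed
  then show ?thesis by (intro exI[of _ "\<Sum>i\<le>N+1. \<bar>c i\<bar>"]) (auto intro: sum_nonneg)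
qed

definition C :: real where
  "C = (SOME C. 0 \<le> C \<and> (\<forall>j\<le>N + 1. \<forall>t. \<bar>(deriv ^^ j) \<nu> t\<bar> \<le> C * \<nu> t))"

lemma C_nonneg: "0 \<le> C"
  and C_bound: "j \<le> N + 1 \<Longrightarrow> \<bar>(deriv ^^ j) \<nu> t\<bar> \<le> C * \<nu> t"
  using someI_ex[OF ex_bound] unfolding C_def[symmetric] by auto

lemma has_derivative_iterate:
  assumes "j \<le> N"
  shows "((deriv ^^ j) \<nu> has_real_derivative (deriv ^^ Suc j) \<nu> t) (at t)"
proof -
  have "(deriv ^^ j) \<nu> differentiable (at t)"
    using smooth assms by (auto simp: Ck_real_def)
  then show ?thesis by (simp add: DERIV_deriv_iff_real_differentiable)
qed

lemma continuous_iterate: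
  assumes "j \<le> N + 1"
  shows "continuous_on UNIV ((deriv ^^ j) \<nu>)"
proof (cases "j = N + 1")
  case True
  then show ?thesis using smooth by (simp add: Ck_real_def)
next
  case False
  then have "j \<le> N" using assms by simp
  then show ?thesis
    using has_derivative_iterate by (intro continuous_at_imp_continuous_on) (blast intro: DERIV_isCont)
qed

lemma measurable_iterate [measurable]:
  "j \<le> N + 1 \<Longrightarrow> (deriv ^^ j) \<nu> \<in> borel_measurable borel"
  using continuous_iterate by (rule borel_measurable_continuous_onI)

lemma measurable_density [measurable]: "\<nu> \<in> borel_measurable borel"
  using measurable_iterate[of 0] by simp

lemma shift_bound: "\<nu> (t + s) \<le> exp (C * \<bar>s\<bar>) * \<nu> t"
proof (rule log_derivative_bound_shift)
  show "\<nu> differentiable at t" for t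
    using has_derivative_iterate[of 0 t] real_differentiable_def by auto
  show "\<bar>deriv \<nu> t\<bar> \<le> C * \<nu> t" for t using C_bound[of 1 t] by simp
qed (rule pos)

lemma integrable_\<nu>: "integrable lborel \<nu>" and integral_\<nu>: "(\<integral>y. \<nu> y \<partial>lborel) = 1"
  using density by (auto simp: prob_density_def has_bochner_integral_iff)

section \<open>Moments of the weight under shifted densities\<close>

lemma integrable_weight_density: "integrable lborel (\<lambda>y. (1 + \<bar>y\<bar>) powr \<delta> * \<nu> y)"
proof (rule Bochner_Integration.integrable_bound)
  show "integrable lborel (\<lambda>y. 2 * \<nu> y + \<bar>y\<bar> powr r * \<nu> y)"
    using integrable_\<nu> moment by auto
  show "AE y in lborel. norm ((1 + \<bar>y\<bar>) powr \<delta> * \<nu> y) \<le> norm (2 * \<nu> y + \<bar>y\<bar> powr r * \<nu> y)"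
  proof (rule AE_I2)
    fix y
    have "(1 + \<bar>y\<bar>) powr \<delta> * \<nu> y \<le> (2 + \<bar>y\<bar> powr r) * \<nu> y"
      using powr_one_plus_abs_le[of \<delta> r y] \<delta>_bounds r_ge_1 pos[of y]
      by (intro mult_right_mono) auto
    then show "norm ((1 + \<bar>y\<bar>) powr \<delta> * \<nu> y) \<le> norm (2 * \<nu> y + \<bar>y\<bar> powr r * \<nu> y)"
      using pos[of y] by (simp add: algebra_simps)
  qed
qed measurable

definition A :: real where "A = (\<integral>y. (1 + \<bar>y\<bar>) powr \<delta> * \<nu> y \<partial>lborel)"

lemma A_nonneg: "0 \<le> A"
  unfolding A_def by (intro integral_nonneg_AE AE_I2 mult_nonneg_nonneg) (simp_all add: pos less_imp_le)

lemma integrable_weight_shift: "integrable lborel (\<lambda>y. (1 + \<bar>y\<bar>) powr \<delta> * \<nu> (y - w))" (is ?i)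
  and integral_weight_shift:
    "(\<integral>y. (1 + \<bar>y\<bar>) powr \<delta> * \<nu> (y - w) \<partial>lborel) \<le> A * (1 + \<bar>w\<bar>) powr \<delta>" (is ?b)
proof -
  \<comment> \<open>The majorant splits \<open>y = w + (y - w)\<close> in the weight. The shape
    \<open>-w + 1 * y\<close> is that of the affine substitution rule with factor 1.\<close>
  let ?g = "\<lambda>y. (1 + \<bar>w\<bar>) powr \<delta> * ((1 + \<bar>-w + 1 * y\<bar>) powr \<delta> * \<nu> (-w + 1 * y))"
  have g: "integrable lborel ?g"
    using lborel_integrable_real_affine[OF integrable_weight_density, of 1 "-w"]
    by (intro integrable_mult_right) auto
  have le: "(1 + \<bar>y\<bar>) powr \<delta> * \<nu> (y - w) \<le> ?g y" for y
    using powr_one_plus_abs_add[of \<delta> w "y - w"] \<delta>_bounds pos[of "y - w"] by simp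
  show i: ?i
  proof (rule Bochner_Integration.integrable_bound[OF g])
    show "AE y in lborel. norm ((1 + \<bar>y\<bar>) powr \<delta> * \<nu> (y - w)) \<le> norm (?g y)"
      using order_trans[OF le abs_ge_self] pos[THEN less_imp_le] by (intro AE_I2) (simp add: abs_mult)
  qed measurable
  have "(\<integral>y. (1 + \<bar>y\<bar>) powr \<delta> * \<nu> (y - w) \<partial>lborel) \<le> integral\<^sup>L lborel ?g"
    using i g le by (intro integral_mono) auto
  also have "\<dots> = (1 + \<bar>w\<bar>) powr \<delta> * A"
    using lborel_integral_real_affine[of 1 "\<lambda>y. (1 + \<bar>y\<bar>) powr \<delta> * \<nu> y" "-w"]
    by (simp add: A_def)
  finally show ?b by (simp add: mult.commute)
qed

text \<open>Stands for membership in the weighted space with norm at most \<open>K\<close>. Carrying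
  \<open>K\<close> explicitly keeps every estimate linear in it, hence uniform over the unit ball,
  without handling a supremum.\<close>

definition dominated :: "real \<Rightarrow> (real \<Rightarrow> complex) \<Rightarrow> bool" where
  "dominated K f \<longleftrightarrow> f \<in> borel_measurable borel \<and> (\<forall>x. cmod (f x) \<le> K * (1 + \<bar>x\<bar>) powr \<delta>)"

lemma dominated_nonneg: "dominated K f \<Longrightarrow> 0 \<le> K"
  unfolding dominated_def using order_trans[OF norm_ge_zero[of "f 0"]] by (auto dest!: spec[of _ 0])

lemma dominated_measurable: "dominated K f \<Longrightarrow> f \<in> borel_measurable borel"
  by (simp add: dominated_def)

text \<open>The \<open>m\<close>-th derivative of the smoothed function of \<open>w\<close>: each
  differentiation falls on \<open>\<nu>\<close> at \<open>y - w\<close> and contributes a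
  sign.\<close>

definition psi :: "(real \<Rightarrow> complex) \<Rightarrow> nat \<Rightarrow> real \<Rightarrow> complex" where
  "psi f m w = (\<integral>y. f y * complex_of_real ((-1) ^ m * (deriv ^^ m) \<nu> (y - w)) \<partial>lborel)"

text \<open>The derivatives of \<open>\<nu>\<close> are bounded relative to \<open>\<nu>\<close>
  itself, so one majorant serves all orders \<open>m\<close>.\<close>

lemma psi_integrand_bound:
  assumes "dominated K f" "m \<le> N + 1"
  shows "cmod (f y * complex_of_real ((-1) ^ m * (deriv ^^ m) \<nu> (y - w)))
    \<le> C * K * ((1 + \<bar>y\<bar>) powr \<delta> * \<nu> (y - w))"
proof -
  have "cmod (f y) * \<bar>(deriv ^^ m) \<nu> (y - w)\<bar> \<le> (K * (1 + \<bar>y\<bar>) powr \<delta>) * (C * \<nu> (y - w))"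
    using assms C_bound[OF assms(2), of "y - w"] dominated_nonneg[OF assms(1)]
    by (intro mult_mono) (auto simp: dominated_def)
  then show ?thesis by (simp add: norm_mult norm_power mult_ac)
qed

lemma integrable_psi:
  assumes "dominated K f" "m \<le> N + 1"
  shows "integrable lborel (\<lambda>y. f y * complex_of_real ((-1) ^ m * (deriv ^^ m) \<nu> (y - w)))"
proof (rule Bochner_Integration.integrable_bound)
  show "integrable lborel (\<lambda>y. C * K * ((1 + \<bar>y\<bar>) powr \<delta> * \<nu> (y - w)))"
    using integrable_weight_shift by (intro integrable_mult_right)
  show "(\<lambda>y. f y * complex_of_real ((-1) ^ m * (deriv ^^ m) \<nu> (y - w))) \<in> borel_measurable lborel"
    using dominated_measurable[OF assms(1)] measurable_iterate[OF assms(2)] by measurable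
  show "AE y in lborel. cmod (f y * complex_of_real ((-1) ^ m * (deriv ^^ m) \<nu> (y - w)))
      \<le> norm (C * K * ((1 + \<bar>y\<bar>) powr \<delta> * \<nu> (y - w)))"
    using order_trans[OF psi_integrand_bound[OF assms] abs_ge_self]
    unfolding real_norm_def by (intro AE_I2)
qed

lemma psi_bound:
  assumes "dominated K f" "m \<le> N + 1"
  shows "cmod (psi f m w) \<le> C * A * K * (1 + \<bar>w\<bar>) powr \<delta>"
proof -
  have "cmod (psi f m w) \<le> (\<integral>y. C * K * ((1 + \<bar>y\<bar>) powr \<delta> * \<nu> (y - w)) \<partial>lborel)"
    unfolding psi_def
  proof (rule Bochner_Integration.integral_norm_bound_integral)
    show "integrable lborel (\<lambda>y. C * K * ((1 + \<bar>y\<bar>) powr \<delta> * \<nu> (y - w)))"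
      using integrable_weight_shift by (intro integrable_mult_right)
  qed (use integrable_psi[OF assms] psi_integrand_bound[OF assms] in auto)
  also have "\<dots> = C * K * (\<integral>y. (1 + \<bar>y\<bar>) powr \<delta> * \<nu> (y - w) \<partial>lborel)"
    by simp
  also have "\<dots> \<le> C * K * (A * (1 + \<bar>w\<bar>) powr \<delta>)"
    using integral_weight_shift C_nonneg dominated_nonneg[OF assms(1)] by (intro mult_left_mono) auto
  finally show ?thesis by (simp add: mult_ac)
qed

lemma psi_has_derivative:
  assumes f: "dominated K f" and m: "m \<le> N"
  shows "(psi f m has_vector_derivative psi f (Suc m) w) (at w)"
  unfolding psi_def[abs_def]
proof (rule has_vector_derivative_integral_dominated[where e = 1
    and w = "\<lambda>y. C * K * exp C * ((1 + \<bar>y\<bar>) powr \<delta> * \<nu> (y - w))"])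
  show "integrable lborel (\<lambda>y. f y * complex_of_real ((-1) ^ m * (deriv ^^ m) \<nu> (y - t)))" for t
    using integrable_psi[OF f] m by simp
  show "(\<lambda>y. f y * complex_of_real ((-1) ^ Suc m * (deriv ^^ Suc m) \<nu> (y - w)))
      \<in> borel_measurable lborel"
    using integrable_psi[OF f, of "Suc m"] m by auto
  show "integrable lborel (\<lambda>y. C * K * exp C * ((1 + \<bar>y\<bar>) powr \<delta> * \<nu> (y - w)))"
    using integrable_weight_shift by (intro integrable_mult_right)
  show "AE y in lborel. \<forall>t. \<bar>t - w\<bar> < 1 \<longrightarrow>
      ((\<lambda>t. f y * complex_of_real ((-1) ^ m * (deriv ^^ m) \<nu> (y - t))) has_vector_derivative
        f y * complex_of_real ((-1) ^ Suc m * (deriv ^^ Suc m) \<nu> (y - t))) (at t) \<and>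
      cmod (f y * complex_of_real ((-1) ^ Suc m * (deriv ^^ Suc m) \<nu> (y - t)))
        \<le> C * K * exp C * ((1 + \<bar>y\<bar>) powr \<delta> * \<nu> (y - w))"
  proof (intro AE_I2 allI impI conjI)
    fix y t :: real assume t: "\<bar>t - w\<bar> < 1"
    have "((\<lambda>t. (deriv ^^ m) \<nu> (y - t)) has_real_derivative - (deriv ^^ Suc m) \<nu> (y - t)) (at t)"
      using DERIV_chain2[OF has_derivative_iterate[OF m], of "\<lambda>t. y - t" "-1" t UNIV]
        DERIV_diff[OF DERIV_const DERIV_ident, of y t UNIV]
      by simp
    then have "((\<lambda>t. (-1) ^ m * (deriv ^^ m) \<nu> (y - t)) has_real_derivative
        (-1) ^ Suc m * (deriv ^^ Suc m) \<nu> (y - t)) (at t)"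
      by (auto intro!: derivative_eq_intros)
    then show "((\<lambda>t. f y * complex_of_real ((-1) ^ m * (deriv ^^ m) \<nu> (y - t))) has_vector_derivative
        f y * complex_of_real ((-1) ^ Suc m * (deriv ^^ Suc m) \<nu> (y - t))) (at t)"
      by (intro has_vector_derivative_mult_right has_vector_derivative_of_real)
        (simp add: has_real_derivative_iff_has_vector_derivative)
    \<comment> \<open>\<open>shift_bound\<close> recentres the majorant from \<open>t\<close> to the
      fixed point \<open>w\<close>. As \<open>|t - w| < 1\<close>, the loss is the factor
      \<open>exp C\<close> in the majorant.\<close>
    have "\<nu> (y - t) \<le> exp (C * \<bar>w - t\<bar>) * \<nu> (y - w)"
      using shift_bound[of "y - w" "w - t"] by simp
    also have "\<dots> \<le> exp C * \<nu> (y - w)"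
      using t C_nonneg pos[of "y - w"] mult_left_le[of "\<bar>w - t\<bar>" C]
      by (intro mult_right_mono) auto
    finally have nu: "\<nu> (y - t) \<le> exp C * \<nu> (y - w)" .
    have "cmod (f y * complex_of_real ((-1) ^ Suc m * (deriv ^^ Suc m) \<nu> (y - t)))
        \<le> C * K * ((1 + \<bar>y\<bar>) powr \<delta> * \<nu> (y - t))"
      using psi_integrand_bound[OF f, of "Suc m"] m by simp
    also have "\<dots> \<le> C * K * ((1 + \<bar>y\<bar>) powr \<delta> * (exp C * \<nu> (y - w)))"
      using nu C_nonneg dominated_nonneg[OF f] by (intro mult_left_mono) auto
    finally show "cmod (f y * complex_of_real ((-1) ^ Suc m * (deriv ^^ Suc m) \<nu> (y - t)))
        \<le> C * K * exp C * ((1 + \<bar>y\<bar>) powr \<delta> * \<nu> (y - w))"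
      by (simp add: mult_ac)
  qed
qed simp

lemma psi_continuous:
  assumes "dominated K f" "m \<le> N"
  shows "continuous_on UNIV (psi f m)"
  using psi_has_derivative[OF assms]
  by (intro continuous_at_imp_continuous_on) (blast intro: has_vector_derivative_continuous)

lemma psi_measurable [measurable]:
  assumes "dominated K f" "m \<le> N"
  shows "psi f m \<in> borel_measurable borel"
  using psi_continuous[OF assms] by (rule borel_measurable_continuous_onI)

text \<open>Mean value inequality with the bound on order \<open>Suc m\<close>; for
  \<open>m = N\<close> this is where the derivative of \<open>\<nu>\<close> of order
  \<open>N + 1\<close> enters. The weight along the segment is estimated by its value at
  \<open>|v| + |w|\<close>.\<close>

lemma psi_lipschitz:
  assumes f: "dominated K f" and m: "m \<le> N"
  shows "cmod (psi f m v - psi f m w) \<le> C * A * K * (1 + \<bar>v\<bar> + \<bar>w\<bar>) powr \<delta> * \<bar>v - w\<bar>"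
proof (rule vector_derivative_bound[OF psi_has_derivative[OF f m]])
  fix t assume "t \<in> closed_segment w v"
  then have t: "\<bar>t\<bar> \<le> \<bar>v\<bar> + \<bar>w\<bar>" by (auto simp: closed_segment_eq_real_ivl split: if_splits)
  have "cmod (psi f (Suc m) t) \<le> C * A * K * (1 + \<bar>t\<bar>) powr \<delta>"
    using psi_bound[OF f, of "Suc m"] m by simp
  also have "\<dots> \<le> C * A * K * (1 + \<bar>v\<bar> + \<bar>w\<bar>) powr \<delta>"
    using t \<delta>_bounds C_nonneg A_nonneg dominated_nonneg[OF f]
    by (intro mult_left_mono powr_mono2) auto
  finally show "cmod (psi f (Suc m) t) \<le> C * A * K * (1 + \<bar>v\<bar> + \<bar>w\<bar>) powr \<delta>" .
qed

end

section \<open>The power series of the past noise\<close>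

text \<open>The shift of the index leaves a zero constant term and yields an ordinary power series
  in \<open>\<alpha>\<close>, open to \<open>diffs\<close> and termwise differentiation.\<close>

definition drift_coeff :: "(nat \<Rightarrow> real) \<Rightarrow> nat \<Rightarrow> real" where
  "drift_coeff \<omega> n = (case n of 0 \<Rightarrow> 0 | Suc k \<Rightarrow> \<omega> k)"

text \<open>
  \<open>drift i \<alpha> \<omega>\<close> is the \<open>i\<close>-th derivative in \<open>\<alpha>\<close> of the power series \<open>\<Sum>k. \<omega>\<^sub>k \<alpha>^(k+1)\<close>.
\<close>

definition drift :: "nat \<Rightarrow> real \<Rightarrow> (nat \<Rightarrow> real) \<Rightarrow> real" where
  "drift i \<alpha> \<omega> = (\<Sum>n. (diffs ^^ i) (drift_coeff \<omega>) n * \<alpha> ^ n)"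

definition path_moment :: "real \<Rightarrow> real \<Rightarrow> (nat \<Rightarrow> real) \<Rightarrow> real" where
  "path_moment r b \<omega> = (\<Sum>k. b ^ k * \<bar>\<omega> k\<bar> powr r)"

text \<open>The size \<open>M\<close> of a noise path: the root makes \<open>M powr r\<close>
  integrable, and the added 1 gives \<open>M \<ge> 1\<close>, so that powers of \<open>M\<close>
  increase with the exponent.\<close>

definition path_bound :: "real \<Rightarrow> real \<Rightarrow> (nat \<Rightarrow> real) \<Rightarrow> real" where
  "path_bound r b \<omega> = (1 + path_moment r b \<omega>) powr (1 / r)"

text \<open>Separates the universal factor, the rising product
  \<open>(n + 1) * ... * (n + i)\<close>, from the coefficients that depend on the path.\<close>

lemma diffs_iterate_eq:
  fixes c :: "nat \<Rightarrow> real"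
  shows "(diffs ^^ i) c n = (diffs ^^ i) (\<lambda>_. 1) n * c (n + i)"
  by (induction i arbitrary: n) (simp_all add: diffs_def)

lemma diffs_iterate_one_nonneg: "0 \<le> (diffs ^^ i) (\<lambda>_. 1 :: real) n"
  by (induction i arbitrary: n) (simp_all add: diffs_def)

lemma summable_diffs_iterate:
  fixes c :: "nat \<Rightarrow> real"
  assumes "\<And>x. \<bar>x\<bar> < b \<Longrightarrow> summable (\<lambda>n. c n * x ^ n)" "\<bar>x\<bar> < b"
  shows "summable (\<lambda>n. (diffs ^^ i) c n * x ^ n)"
  using assms(2)
proof (induction i arbitrary: x)
  case 0
  then show ?case using assms(1) by simp
next
  case (Suc i)
  then show ?case
    using termdiff_converges[of x b "(diffs ^^ i) c"] by simp
qed

text \<open>Terms of a convergent series are bounded: geometric decay beats the polynomial factor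
  that \<open>i\<close> differentiations produce.\<close>

lemma diffs_iterate_one_bounded:
  fixes x :: real
  assumes "0 \<le> x" "x < 1"
  shows "\<exists>K\<ge>0. \<forall>n. (diffs ^^ i) (\<lambda>_. 1) n * x ^ n \<le> K"
proof -
  have "summable (\<lambda>n. (diffs ^^ i) (\<lambda>_. 1) n * x ^ n)"
    using assms by (intro summable_diffs_iterate[where b = 1]) (auto intro: summable_geometric)
  then have "Bseq (\<lambda>n. (diffs ^^ i) (\<lambda>_. 1) n * x ^ n)"
    by (intro convergent_imp_Bseq) (auto dest: summable_LIMSEQ_zero simp: convergent_def)
  then obtain K where "0 < K" "\<And>n. norm ((diffs ^^ i) (\<lambda>_. 1) n * x ^ n) \<le> K"
    unfolding Bseq_def by blast
  then show ?thesis by (intro exI[of _ K]) (auto intro: order_trans[OF abs_ge_self])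
qed

text \<open>A linear substitute for Hoelder's inequality with a free parameter \<open>c\<close>: the
  second summand is \<open>x * (x / c) powr (r - 1)\<close>, which is at least \<open>x\<close> as
  soon as \<open>x > c\<close>.\<close>

lemma le_add_powr:
  fixes x c r :: real
  assumes "0 \<le> x" "0 < c" "1 \<le> r"
  shows "x \<le> c + c powr (1 - r) * x powr r"
proof (cases "x \<le> c")
  case True
  then show ?thesis by (simp add: add_increasing2)
next
  case False
  then have x: "0 < x" using assms by simp
  have "c powr (r - 1) \<le> x powr (r - 1)" using False assms by (intro powr_mono2) auto
  then have "c powr (1 - r) * c powr (r - 1) * x \<le> c powr (1 - r) * x powr (r - 1) * x"
    using x by (intro mult_right_mono mult_left_mono) auto
  moreover have "c powr (1 - r) * c powr (r - 1) = 1"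
    using assms by (simp add: powr_add[symmetric])
  moreover have "x powr (r - 1) * x = x powr r"
    using powr_add[of x "r - 1" 1] x by simp
  ultimately show ?thesis using assms by (simp add: mult.assoc)
qed

section \<open>Estimates along one fixed noise path\<close>

context
  fixes r b :: real and \<omega> :: "nat \<Rightarrow> real"
  assumes r: "1 \<le> r" and b: "0 < b" "b < 1"
    and good: "summable (\<lambda>k. b ^ k * \<bar>\<omega> k\<bar> powr r)"
begin

lemma path_moment_nonneg: "0 \<le> path_moment r b \<omega>"
  unfolding path_moment_def using good b by (intro suminf_nonneg) auto

lemma path_bound_ge_1: "1 \<le> path_bound r b \<omega>"
  unfolding path_bound_def using path_moment_nonneg r by (intro ge_one_powr_ge_zero) auto

lemma path_bound_powr: "path_bound r b \<omega> powr r = 1 + path_moment r b \<omega>"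
  unfolding path_bound_def using path_moment_nonneg r by (simp add: powr_powr)

lemma summable_path: "summable (\<lambda>k. b ^ k * \<bar>\<omega> k\<bar>)"
  and sum_path_le: "(\<Sum>k. b ^ k * \<bar>\<omega> k\<bar>) \<le> (1 / (1 - b) + 1) * path_bound r b \<omega>"
proof -
  \<comment> \<open>Choice of the parameter in \<open>le_add_powr\<close>: with \<open>c = M\<close>
    the second part sums to at most \<open>M powr (1 - r) * M powr r = M\<close>, so the whole sum
    is linear in \<open>M\<close>.\<close>
  let ?c = "path_bound r b \<omega>"
  let ?g = "\<lambda>k. b ^ k * ?c + ?c powr (1 - r) * (b ^ k * \<bar>\<omega> k\<bar> powr r)"
  have c: "0 < ?c" using path_bound_ge_1 by simp
  have geo: "(\<lambda>k. b ^ k * ?c) sums (1 / (1 - b) * ?c)"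
    using b by (intro sums_mult2 geometric_sums) auto
  have S: "(\<lambda>k. ?c powr (1 - r) * (b ^ k * \<bar>\<omega> k\<bar> powr r)) sums (?c powr (1 - r) * path_moment r b \<omega>)"
    unfolding path_moment_def using good by (intro sums_mult summable_sums)
  have g: "?g sums (1 / (1 - b) * ?c + ?c powr (1 - r) * path_moment r b \<omega>)"
    by (rule sums_add[OF geo S])
  have le: "b ^ k * \<bar>\<omega> k\<bar> \<le> ?g k" for k
  proof -
    have "b ^ k * \<bar>\<omega> k\<bar> \<le> b ^ k * (?c + ?c powr (1 - r) * \<bar>\<omega> k\<bar> powr r)"
      using le_add_powr[of "\<bar>\<omega> k\<bar>" ?c r] c r b by (intro mult_left_mono) auto
    then show ?thesis by (simp add: algebra_simps)
  qed
  show s: "summable (\<lambda>k. b ^ k * \<bar>\<omega> k\<bar>)"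
    by (rule summable_comparison_test'[OF sums_summable[OF g], of 0]) (use le b in auto)
  have "(\<Sum>k. b ^ k * \<bar>\<omega> k\<bar>) \<le> suminf ?g"
    by (rule suminf_le[OF le s sums_summable[OF g]])
  also have "\<dots> = 1 / (1 - b) * ?c + ?c powr (1 - r) * path_moment r b \<omega>"
    using g by (simp add: sums_iff)
  also have "?c powr (1 - r) * path_moment r b \<omega> \<le> ?c powr (1 - r) * ?c powr r"
    using path_bound_powr by (intro mult_left_mono) auto
  also have "?c powr (1 - r) * ?c powr r = ?c"
    using c by (simp add: powr_add[symmetric])
  finally show "(\<Sum>k. b ^ k * \<bar>\<omega> k\<bar>) \<le> (1 / (1 - b) + 1) * ?c"
    by (simp add: algebra_simps)
qed

lemma summable_drift_coeff: "summable (\<lambda>n. b ^ n * \<bar>drift_coeff \<omega> n\<bar>)"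
proof -
  have "summable (\<lambda>k. b ^ Suc k * \<bar>drift_coeff \<omega> (Suc k)\<bar>)"
    using summable_mult[OF summable_path, of b] by (simp add: drift_coeff_def mult_ac)
  then show ?thesis by (rule summable_Suc_iff[THEN iffD1])
qed

lemma sum_drift_coeff_le: "(\<Sum>n. b ^ n * \<bar>drift_coeff \<omega> n\<bar>) \<le> (1 / (1 - b) + 1) * path_bound r b \<omega>"
proof -
  have "(\<Sum>n. b ^ n * \<bar>drift_coeff \<omega> n\<bar>) = (\<Sum>k. b ^ Suc k * \<bar>drift_coeff \<omega> (Suc k)\<bar>)"
    using suminf_split_head[OF summable_drift_coeff] by (simp add: drift_coeff_def)
  also have "\<dots> = b * (\<Sum>k. b ^ k * \<bar>\<omega> k\<bar>)"
    using suminf_mult[OF summable_path, of b] by (simp add: drift_coeff_def mult_ac)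
  also have "\<dots> \<le> 1 * (\<Sum>k. b ^ k * \<bar>\<omega> k\<bar>)"
    using b by (intro mult_right_mono suminf_nonneg summable_path) auto
  finally show ?thesis using sum_path_le by simp
qed

lemma summable_drift:
  assumes "\<bar>x\<bar> < b"
  shows "summable (\<lambda>n. (diffs ^^ i) (drift_coeff \<omega>) n * x ^ n)"
proof (rule summable_diffs_iterate[OF _ assms])
  fix x :: real assume x: "\<bar>x\<bar> < b"
  show "summable (\<lambda>n. drift_coeff \<omega> n * x ^ n)"
  proof (rule summable_comparison_test'[OF summable_drift_coeff, of 0])
    fix n :: nat
    have "\<bar>drift_coeff \<omega> n\<bar> * \<bar>x\<bar> ^ n \<le> \<bar>drift_coeff \<omega> n\<bar> * b ^ n"
      using x by (intro mult_left_mono power_mono) auto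
    then show "norm (drift_coeff \<omega> n * x ^ n) \<le> b ^ n * \<bar>drift_coeff \<omega> n\<bar>"
      by (simp add: abs_mult power_abs mult.commute)
  qed
qed

lemma drift_has_derivative:
  assumes "\<bar>\<alpha>\<bar> < b"
  shows "((\<lambda>\<alpha>. drift i \<alpha> \<omega>) has_real_derivative drift (Suc i) \<alpha> \<omega>) (at \<alpha>)"
  using termdiffs_strong'[of b "(diffs ^^ i) (drift_coeff \<omega>)" \<alpha>] summable_drift assms
  by (simp add: drift_def)

end

text \<open>The powers of \<open>b\<close> make the series of the path converge, and the gap between
  \<open>a\<close> and \<open>b\<close>, through \<open>(a / b) ^ n\<close>, absorbs the polynomial
  factor of the derivatives. The result is linear in the path size for every \<open>i\<close>, with
  \<open>K\<close> independent of path and parameter.\<close>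

lemma drift_bound:
  assumes "0 \<le> a" "a < b" "b < 1" "1 \<le> r"
  shows "\<exists>K\<ge>0. \<forall>\<omega> \<alpha>. summable (\<lambda>k. b ^ k * \<bar>\<omega> k\<bar> powr r) \<longrightarrow> \<bar>\<alpha>\<bar> \<le> a \<longrightarrow>
    \<bar>drift i \<alpha> \<omega>\<bar> \<le> K * path_bound r b \<omega>"
proof -
  have b: "0 < b" using assms by simp
  obtain K where K: "0 \<le> K" "\<And>n. (diffs ^^ i) (\<lambda>_. 1) n * (a / b) ^ n \<le> K"
    using diffs_iterate_one_bounded[of "a / b" i] assms by auto
  show ?thesis
  proof (intro exI[of _ "K / b ^ i * (1 / (1 - b) + 1)"] conjI allI impI)
    show "0 \<le> K / b ^ i * (1 / (1 - b) + 1)" using K b assms by simp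
    fix \<omega> \<alpha> assume good: "summable (\<lambda>k. b ^ k * \<bar>\<omega> k\<bar> powr r)" and \<alpha>: "\<bar>\<alpha>\<bar> \<le> a"
    note facts = \<open>1 \<le> r\<close> b \<open>b < 1\<close> good
    let ?c = "\<lambda>n. b ^ n * \<bar>drift_coeff \<omega> n\<bar>"
    have le: "\<bar>(diffs ^^ i) (drift_coeff \<omega>) n * \<alpha> ^ n\<bar> \<le> K / b ^ i * ?c (n + i)" for n
    proof -
      let ?d = "(diffs ^^ i) (\<lambda>_. 1 :: real) n"
      have "\<bar>(diffs ^^ i) (drift_coeff \<omega>) n * \<alpha> ^ n\<bar> = ?d * \<bar>\<alpha>\<bar> ^ n * \<bar>drift_coeff \<omega> (n + i)\<bar>"
        using diffs_iterate_one_nonneg[of i n]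
        by (simp add: diffs_iterate_eq[of i "drift_coeff \<omega>"] abs_mult power_abs)
      also have "\<dots> \<le> ?d * a ^ n * \<bar>drift_coeff \<omega> (n + i)\<bar>"
        using \<alpha> diffs_iterate_one_nonneg[of i n] by (intro mult_right_mono mult_left_mono power_mono) auto
      also have "?d * a ^ n = (?d * (a / b) ^ n) * b ^ n"
        using b by (simp add: power_divide)
      also have "\<dots> * \<bar>drift_coeff \<omega> (n + i)\<bar> \<le> K * b ^ n * \<bar>drift_coeff \<omega> (n + i)\<bar>"
        using K b by (intro mult_right_mono) auto
      also have "\<dots> = K / b ^ i * ?c (n + i)"
        using b by (simp add: power_add)
      finally show ?thesis .
    qed
    have sc: "summable ?c" by (rule summable_drift_coeff[OF facts])
    then have sci: "summable (\<lambda>n. K / b ^ i * ?c (n + i))"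
      by (intro summable_mult summable_ignore_initial_segment)
    have norm_le: "norm ((diffs ^^ i) (drift_coeff \<omega>) n * \<alpha> ^ n) \<le> K / b ^ i * ?c (n + i)" for n
      using le by simp
    have "\<bar>drift i \<alpha> \<omega>\<bar> \<le> (\<Sum>n. K / b ^ i * ?c (n + i))"
      using norm_suminf_le[OF norm_le sci] by (simp add: drift_def)
    also have "\<dots> = K / b ^ i * (\<Sum>n. ?c (n + i))"
      using sc by (intro suminf_mult summable_ignore_initial_segment)
    also have "\<dots> \<le> K / b ^ i * ((1 / (1 - b) + 1) * path_bound r b \<omega>)"
    proof (rule mult_left_mono)
      have "suminf ?c = (\<Sum>n. ?c (n + i)) + (\<Sum>n<i. ?c n)"
        by (rule suminf_split_initial_segment[OF sc])
      moreover have "0 \<le> (\<Sum>n<i. ?c n)" using b by (intro sum_nonneg) auto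
      ultimately show "(\<Sum>n. ?c (n + i)) \<le> (1 / (1 - b) + 1) * path_bound r b \<omega>"
        using sum_drift_coeff_le[OF facts] by linarith
    qed (use K b in simp)
    finally show "\<bar>drift i \<alpha> \<omega>\<bar> \<le> K / b ^ i * (1 / (1 - b) + 1) * path_bound r b \<omega>"
      by (simp only: mult.assoc)
  qed
qed

text \<open>
  A list \<open>l\<close> of derivative orders stands for the product of \<open>drift i \<alpha> \<omega>\<close> over \<open>i\<close> in \<open>l\<close>, multiplied
  (in \<open>path_term\<close> below) by the derivative of order \<open>length l\<close> of the smoothed function at \<open>drift 0 \<alpha> \<omega>\<close>.
  Differentiating such a term in \<open>\<alpha>\<close> gives the sum of the terms in \<open>diff_step l\<close>.
\<close>

definition drift_prod :: "nat list \<Rightarrow> real \<Rightarrow> (nat \<Rightarrow> real) \<Rightarrow> real" where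
  "drift_prod l \<alpha> \<omega> = prod_list (map (\<lambda>i. drift i \<alpha> \<omega>) l)"

fun diff_list :: "nat list \<Rightarrow> nat list list" where
  "diff_list [] = []"
| "diff_list (i # l) = (Suc i # l) # map ((#) i) (diff_list l)"

text \<open>The head is the chain rule: a new factor \<open>drift 1\<close>, the longer list
  recording the higher derivative of the smoothed function. \<open>diff_list\<close> is the product
  rule.\<close>

definition diff_step :: "nat list \<Rightarrow> nat list list" where
  "diff_step l = (1 # l) # diff_list l"

text \<open>Faa di Bruno's formula, with its multiplicities kept as repeated lists instead of
  coefficients.\<close>

primrec diff_level :: "nat \<Rightarrow> nat list list" where
  "diff_level 0 = [[]]"
| "diff_level (Suc j) = concat (map diff_step (diff_level j))"

lemma length_diff_list: "l' \<in> set (diff_list l) \<Longrightarrow> length l' = length l"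
  by (induction l arbitrary: l') auto

lemma length_diff_step: "l' \<in> set (diff_step l) \<Longrightarrow> length l' \<le> Suc (length l)"
  by (auto simp: diff_step_def dest: length_diff_list)

text \<open>The length counts both the noise factors and the order of \<open>psi\<close>, so this
  bound is what controls integrability at level \<open>j\<close>.\<close>

lemma length_diff_level: "l \<in> set (diff_level j) \<Longrightarrow> length l \<le> j"
proof (induction j arbitrary: l)
  case (Suc j)
  then obtain k where "k \<in> set (diff_level j)" "l \<in> set (diff_step k)" by auto
  then show ?case using Suc.IH[of k] length_diff_step[of l k] by simp
qed simp

lemma drift_prod_has_derivative:
  assumes "1 \<le> r" "0 < b" "b < 1" "summable (\<lambda>k. b ^ k * \<bar>\<omega> k\<bar> powr r)" "\<bar>\<alpha>\<bar> < b"
  shows "((\<lambda>\<alpha>. drift_prod l \<alpha> \<omega>) has_real_derivative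
    (\<Sum>l'\<leftarrow>diff_list l. drift_prod l' \<alpha> \<omega>)) (at \<alpha>)"
proof (induction l)
  case (Cons i l)
  have "((\<lambda>\<alpha>. drift i \<alpha> \<omega> * drift_prod l \<alpha> \<omega>) has_real_derivative
      drift (Suc i) \<alpha> \<omega> * drift_prod l \<alpha> \<omega> +
      (\<Sum>l'\<leftarrow>diff_list l. drift_prod l' \<alpha> \<omega>) * drift i \<alpha> \<omega>) (at \<alpha>)"
    by (rule DERIV_mult[OF drift_has_derivative[OF assms] Cons])
  then show ?case
    by (simp add: drift_prod_def sum_list_const_mult[symmetric] o_def mult.commute)
qed (simp add: drift_prod_def)

text \<open>One power of the path size per factor: the exponent depends on the number of factors,
  not on their orders of differentiation.\<close>

lemma drift_prod_bound:
  assumes "0 \<le> a" "a < b" "b < 1" "1 \<le> r"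
  shows "\<exists>K\<ge>0. \<forall>\<omega> \<alpha>. summable (\<lambda>k. b ^ k * \<bar>\<omega> k\<bar> powr r) \<longrightarrow> \<bar>\<alpha>\<bar> \<le> a \<longrightarrow>
    \<bar>drift_prod l \<alpha> \<omega>\<bar> \<le> K * path_bound r b \<omega> ^ length l"
proof (induction l)
  case Nil
  show ?case by (intro exI[of _ 1]) (simp add: drift_prod_def)
next
  case (Cons i l)
  obtain K where K: "0 \<le> K" "\<And>\<omega> \<alpha>. summable (\<lambda>k. b ^ k * \<bar>\<omega> k\<bar> powr r) \<Longrightarrow> \<bar>\<alpha>\<bar> \<le> a \<Longrightarrow>
      \<bar>drift i \<alpha> \<omega>\<bar> \<le> K * path_bound r b \<omega>"
    using drift_bound[OF assms, of i] by blast
  obtain L where L: "0 \<le> L" "\<And>\<omega> \<alpha>. summable (\<lambda>k. b ^ k * \<bar>\<omega> k\<bar> powr r) \<Longrightarrow> \<bar>\<alpha>\<bar> \<le> a \<Longrightarrow>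
      \<bar>drift_prod l \<alpha> \<omega>\<bar> \<le> L * path_bound r b \<omega> ^ length l"
    using Cons by blast
  show ?case
  proof (intro exI[of _ "K * L"] conjI allI impI)
    fix \<omega> \<alpha> assume *: "summable (\<lambda>k. b ^ k * \<bar>\<omega> k\<bar> powr r)" "\<bar>\<alpha>\<bar> \<le> a"
    have "\<bar>drift i \<alpha> \<omega>\<bar> * \<bar>drift_prod l \<alpha> \<omega>\<bar> \<le>
        (K * path_bound r b \<omega>) * (L * path_bound r b \<omega> ^ length l)"
      using K(2)[OF *] L(2)[OF *] by (intro mult_mono) auto
    then show "\<bar>drift_prod (i # l) \<alpha> \<omega>\<bar> \<le> K * L * path_bound r b \<omega> ^ length (i # l)"
      by (simp add: drift_prod_def abs_mult mult_ac)
  qed (use K L in simp)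
qed

section \<open>The stationary law\<close>

text \<open>The stationary solution of the recursion, coordinate 0 being the newest noise. Its
  multiple by \<open>\<alpha>\<close> is the power series \<open>drift 0\<close>.\<close>

definition path_sum :: "real \<Rightarrow> (nat \<Rightarrow> real) \<Rightarrow> real" where
  "path_sum \<alpha> \<omega> = (\<Sum>k. \<alpha> ^ k * \<omega> k)"

lemma integrable_pair_mult:
  fixes g :: "'a \<Rightarrow> real" and h :: "'b \<Rightarrow> real"
  assumes "pair_sigma_finite M1 M2" and g: "integrable M1 g" and h: "integrable M2 h"
  shows "integrable (M1 \<Otimes>\<^sub>M M2) (\<lambda>(x, y). g x * h y)"
proof -
  interpret pair_sigma_finite M1 M2 by fact
  have [measurable]: "g \<in> borel_measurable M1" "h \<in> borel_measurable M2" using g h by auto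
  show ?thesis
    by (rule Fubini_integrable) (use g h in \<open>auto simp: abs_mult\<close>)
qed

lemma (in pair_sigma_finite) AE_pair_snd:
  assumes "AE y in M2. P y"
  shows "AE x in M1 \<Otimes>\<^sub>M M2. P (snd x)"
proof -
  from assms obtain Z where Z: "Z \<in> null_sets M2" "{y \<in> space M2. \<not> P y} \<subseteq> Z"
    unfolding eventually_ae_filter by blast
  have [measurable]: "Z \<in> sets M2" using Z by auto
  have "AE x in M1 \<Otimes>\<^sub>M M2. snd x \<notin> Z"
  proof (rule AE_pair_measure)
    show "AE x in M1. AE y in M2. snd (x, y) \<notin> Z"
      using AE_not_in[OF Z(1)] by simp
  qed measurable
  then show ?thesis
    using AE_space
  proof eventually_elim
    case (elim x)
    then show ?case using Z(2) by (auto simp: space_pair_measure)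
  qed
qed

lemma path_sum_case_nat:
  assumes "1 \<le> r" "0 < b" "b < 1" "summable (\<lambda>k. b ^ k * \<bar>\<omega> k\<bar> powr r)" "\<bar>\<alpha>\<bar> < b"
  shows "path_sum \<alpha> (case_nat s \<omega>) = s + \<alpha> * path_sum \<alpha> \<omega>"
    and "drift 0 \<alpha> \<omega> = \<alpha> * path_sum \<alpha> \<omega>"
proof -
  have s: "summable (\<lambda>k. \<alpha> ^ k * \<omega> k)"
  proof (rule summable_comparison_test'[OF summable_path[OF assms(1-4)], of 0])
    fix n :: nat
    have "\<bar>\<alpha>\<bar> ^ n * \<bar>\<omega> n\<bar> \<le> b ^ n * \<bar>\<omega> n\<bar>"
      using assms by (intro mult_right_mono power_mono) auto
    then show "norm (\<alpha> ^ n * \<omega> n) \<le> b ^ n * \<bar>\<omega> n\<bar>" by (simp add: abs_mult power_abs)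
  qed
  have s': "summable (\<lambda>k. \<alpha> ^ Suc k * \<omega> k)"
    using summable_mult[OF s, of \<alpha>] by (simp add: mult.assoc)
  have eq: "(\<Sum>k. \<alpha> ^ Suc k * \<omega> k) = \<alpha> * path_sum \<alpha> \<omega>"
    using suminf_mult[OF s, of \<alpha>] by (simp add: path_sum_def mult.assoc)
  have "summable (\<lambda>k. \<alpha> ^ k * case_nat s \<omega> k)"
    by (rule summable_Suc_iff[THEN iffD1]) (use s' in simp)
  from suminf_split_head[OF this] eq
  show "path_sum \<alpha> (case_nat s \<omega>) = s + \<alpha> * path_sum \<alpha> \<omega>"
    by (simp add: path_sum_def)
  have "summable (\<lambda>n. drift_coeff \<omega> n * \<alpha> ^ n)"
    using summable_drift[OF assms, of 0] by simp
  from suminf_split_head[OF this] eq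
  show "drift 0 \<alpha> \<omega> = \<alpha> * path_sum \<alpha> \<omega>"
    by (simp add: drift_def drift_coeff_def mult.commute)
qed

section \<open>The probability space of noise sequences and its moments\<close>

context smooth_noise
begin

definition noise :: "real measure" where "noise = density lborel (\<lambda>y. ennreal (\<nu> y))"

definition paths :: "(nat \<Rightarrow> real) measure" where "paths = (\<Pi>\<^sub>M i\<in>UNIV. noise)"

lemma sets_noise [simp, measurable_cong]: "sets noise = sets borel"
  and space_noise [simp]: "space noise = UNIV"
  by (simp_all add: noise_def)

lemma prob_space_noise: "prob_space noise"
proof (rule prob_spaceI)
  have "emeasure noise (space noise) = (\<integral>\<^sup>+y. ennreal (\<nu> y) \<partial>lborel)"
    by (simp add: noise_def emeasure_density)
  also have "\<dots> = ennreal (\<integral>y. \<nu> y \<partial>lborel)"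
    using integrable_\<nu> pos less_imp_le by (intro nn_integral_eq_integral) auto
  finally show "emeasure noise (space noise) = 1" by (simp add: integral_\<nu>)
qed

sublocale noise: prob_space noise by (rule prob_space_noise)

sublocale seq: sequence_space noise by unfold_locales

lemma prob_space_paths: "prob_space paths"
  unfolding paths_def by (rule prob_space_PiM) (rule prob_space_noise)

sublocale paths: prob_space paths by (rule prob_space_paths)

sublocale noise_paths: pair_prob_space noise paths ..

lemma integral_noise:
  fixes g :: "real \<Rightarrow> 'b::{banach, second_countable_topology}"
  assumes "g \<in> borel_measurable borel"
  shows "integral\<^sup>L noise g = (\<integral>y. \<nu> y *\<^sub>R g y \<partial>lborel)"
  unfolding noise_def using assms pos by (intro integral_density) (auto intro: less_imp_le)

lemma integrable_noise:
  fixes g :: "real \<Rightarrow> 'b::{banach, second_countable_topology}"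
  assumes "g \<in> borel_measurable borel"
  shows "integrable noise g \<longleftrightarrow> integrable lborel (\<lambda>y. \<nu> y *\<^sub>R g y)"
  unfolding noise_def using assms pos by (intro integrable_density) (auto intro: less_imp_le)

lemma measurable_coordinate_noise: "(\<lambda>\<omega>. \<omega> k) \<in> measurable paths noise"
  unfolding paths_def by (rule measurable_component_singleton) simp

lemma measurable_coordinate: "(\<lambda>\<omega>. \<omega> k) \<in> borel_measurable paths"
  using measurable_coordinate_noise by (simp add: measurable_cong_sets[OF refl sets_noise])

lemma measurable_coordinate_powr [measurable]: "(\<lambda>\<omega>. \<bar>\<omega> k\<bar> powr p) \<in> borel_measurable paths"
  by (intro powr_real_measurable borel_measurable_abs measurable_coordinate borel_measurable_const)

lemma measurable_drift [measurable]: "drift i \<alpha> \<in> borel_measurable paths"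
proof -
  have [measurable]: "(\<lambda>\<omega>. drift_coeff \<omega> k) \<in> borel_measurable paths" for k
    by (cases k) (simp_all add: drift_coeff_def measurable_coordinate)
  show ?thesis
    unfolding drift_def[abs_def]
    by (subst diffs_iterate_eq) measurable
qed

lemma measurable_path_sum [measurable]: "path_sum \<alpha> \<in> borel_measurable paths"
  unfolding path_sum_def[abs_def]
  by (intro borel_measurable_suminf borel_measurable_times borel_measurable_const measurable_coordinate)

lemma measurable_path_moment [measurable]: "path_moment r b \<in> borel_measurable paths"
  unfolding path_moment_def[abs_def] by measurable

lemma measurable_drift_prod [measurable]: "drift_prod l \<alpha> \<in> borel_measurable paths"
  unfolding drift_prod_def[abs_def] by (induction l) simp_all

text \<open>Every coordinate has law \<open>noise\<close>, so the mean is a geometric series times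
  the moment of order \<open>r\<close>. It is computed in \<open>ennreal\<close> because summability
  along almost every path is only deduced from its finiteness.\<close>

lemma nn_integral_path_moment:
  assumes b: "0 < b" "b < 1"
  shows "(\<integral>\<^sup>+\<omega>. (\<Sum>k. ennreal (b ^ k * \<bar>\<omega> k\<bar> powr r)) \<partial>paths) < \<infinity>"
proof -
  have m: "(\<integral>\<^sup>+x. ennreal (\<bar>x\<bar> powr r) \<partial>noise) = ennreal (\<integral>y. \<bar>y\<bar> powr r * \<nu> y \<partial>lborel)"
  proof -
    have "(\<integral>\<^sup>+x. ennreal (\<bar>x\<bar> powr r) \<partial>noise) = (\<integral>\<^sup>+y. ennreal (\<bar>y\<bar> powr r * \<nu> y) \<partial>lborel)"
      unfolding noise_def
      by (subst nn_integral_density)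
        (auto simp: ennreal_mult'' pos less_imp_le mult.commute)
    also have "\<dots> = ennreal (\<integral>y. \<bar>y\<bar> powr r * \<nu> y \<partial>lborel)"
      by (intro nn_integral_eq_integral moment AE_I2 mult_nonneg_nonneg) (simp_all add: pos less_imp_le)
    finally show ?thesis .
  qed
  have c: "(\<integral>\<^sup>+\<omega>. ennreal (\<bar>\<omega> k\<bar> powr r) \<partial>paths) = (\<integral>\<^sup>+x. ennreal (\<bar>x\<bar> powr r) \<partial>noise)" for k
  proof -
    have "noise = distr paths noise (\<lambda>\<omega>. \<omega> k)"
      unfolding paths_def using distr_PiM_component[of UNIV "\<lambda>_. noise" k] prob_space_noise by simp
    then have "(\<integral>\<^sup>+x. ennreal (\<bar>x\<bar> powr r) \<partial>noise) =
        (\<integral>\<^sup>+x. ennreal (\<bar>x\<bar> powr r) \<partial>distr paths noise (\<lambda>\<omega>. \<omega> k))"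
      by simp
    also have "\<dots> = (\<integral>\<^sup>+\<omega>. ennreal (\<bar>\<omega> k\<bar> powr r) \<partial>paths)"
      by (rule nn_integral_distr[OF measurable_coordinate_noise]) measurable
    finally show ?thesis by simp
  qed
  define m where "m = (\<integral>y. \<bar>y\<bar> powr r * \<nu> y \<partial>lborel)"
  have m0: "0 \<le> m" unfolding m_def by (intro integral_nonneg_AE AE_I2 mult_nonneg_nonneg) (simp_all add: pos less_imp_le)
  have "(\<integral>\<^sup>+\<omega>. (\<Sum>k. ennreal (b ^ k * \<bar>\<omega> k\<bar> powr r)) \<partial>paths) =
      (\<Sum>k. \<integral>\<^sup>+\<omega>. ennreal (b ^ k * \<bar>\<omega> k\<bar> powr r) \<partial>paths)"
    by (rule nn_integral_suminf) measurable
  also have "\<dots> = (\<Sum>k. ennreal (b ^ k * m))"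
  proof (rule suminf_cong)
    fix k
    have "(\<integral>\<^sup>+\<omega>. ennreal (b ^ k * \<bar>\<omega> k\<bar> powr r) \<partial>paths) =
        (\<integral>\<^sup>+\<omega>. ennreal (b ^ k) * ennreal (\<bar>\<omega> k\<bar> powr r) \<partial>paths)"
      using b by (simp add: ennreal_mult)
    also have "\<dots> = ennreal (b ^ k) * ennreal m"
      by (subst nn_integral_cmult) (simp_all add: c \<open>(\<integral>\<^sup>+x. ennreal (\<bar>x\<bar> powr r) \<partial>noise) = _\<close> m_def)
    finally show "(\<integral>\<^sup>+\<omega>. ennreal (b ^ k * \<bar>\<omega> k\<bar> powr r) \<partial>paths) = ennreal (b ^ k * m)"
      using b m0 by (simp add: ennreal_mult)
  qed
  also have "\<dots> \<noteq> top"
    using b m0 by (intro ennreal_suminf_neq_top summable_mult2 summable_geometric) auto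
  finally show ?thesis by (simp add: less_top)
qed

lemma AE_good:
  assumes "0 < b" "b < 1"
  shows "AE \<omega> in paths. summable (\<lambda>k. b ^ k * \<bar>\<omega> k\<bar> powr r)"
proof -
  have "AE \<omega> in paths. (\<Sum>k. ennreal (b ^ k * \<bar>\<omega> k\<bar> powr r)) \<noteq> \<infinity>"
    using nn_integral_path_moment[OF assms] by (intro nn_integral_PInf_AE) auto
  then show ?thesis
    by eventually_elim (rule summable_suminf_not_top, use assms in auto)
qed

lemma integrable_path_moment:
  assumes "0 < b" "b < 1"
  shows "integrable paths (path_moment r b)"
proof (rule integrableI_bounded)
  have "(\<integral>\<^sup>+\<omega>. ennreal (norm (path_moment r b \<omega>)) \<partial>paths) =
      (\<integral>\<^sup>+\<omega>. (\<Sum>k. ennreal (b ^ k * \<bar>\<omega> k\<bar> powr r)) \<partial>paths)"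
  proof (rule nn_integral_cong_AE, use AE_good[OF assms] in eventually_elim)
    case (elim \<omega>)
    then show ?case
      using path_moment_nonneg[OF r_ge_1 assms elim] assms
      by (simp add: path_moment_def suminf_ennreal2)
  qed
  then show "(\<integral>\<^sup>+\<omega>. ennreal (norm (path_moment r b \<omega>)) \<partial>paths) < \<infinity>"
    using nn_integral_path_moment[OF assms] by simp
qed measurable

text \<open>Shifting the coordinates of the noise by one turns the series into its own autoregression step.\<close>

lemma distr_path_sum:
  assumes "\<bar>\<alpha>\<bar> < 1"
  shows "distr paths borel (path_sum \<alpha>) =
    distr (noise \<Otimes>\<^sub>M paths) borel (\<lambda>(s, \<omega>). s + \<alpha> * path_sum \<alpha> \<omega>)"
proof -
  define b where "b = (1 + \<bar>\<alpha>\<bar>) / 2"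
  have b: "0 < b" "b < 1" "\<bar>\<alpha>\<bar> < b" using assms by (auto simp: b_def)
  have cn [measurable]: "(\<lambda>(s, \<omega>). case_nat s \<omega>) \<in> measurable (noise \<Otimes>\<^sub>M paths) paths"
    unfolding paths_def by measurable
  have "distr paths borel (path_sum \<alpha>) =
      distr (distr (noise \<Otimes>\<^sub>M paths) paths (\<lambda>(s, \<omega>). case_nat s \<omega>)) borel (path_sum \<alpha>)"
    using seq.PiM_iter by (simp add: paths_def)
  also have "\<dots> = distr (noise \<Otimes>\<^sub>M paths) borel (path_sum \<alpha> \<circ> (\<lambda>(s, \<omega>). case_nat s \<omega>))"
    by (rule distr_distr) measurable
  also have "\<dots> = distr (noise \<Otimes>\<^sub>M paths) borel (\<lambda>(s, \<omega>). s + \<alpha> * path_sum \<alpha> \<omega>)"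
  \<comment> \<open>Agreement is shown on the summable paths, where the head of the series can be
    split off; they have full measure.\<close>
  proof (rule distr_cong_AE)
    show "AE x in noise \<Otimes>\<^sub>M paths. (path_sum \<alpha> \<circ> (\<lambda>(s, \<omega>). case_nat s \<omega>)) x =
        (case x of (s, \<omega>) \<Rightarrow> s + \<alpha> * path_sum \<alpha> \<omega>)"
      using noise_paths.AE_pair_snd[OF AE_good[OF b(1,2)]]
    proof eventually_elim
      case (elim x)
      then show ?case
        using path_sum_case_nat(1)[OF r_ge_1 b(1,2) _ b(3)] by (cases x) simp
    qed
    show "path_sum \<alpha> \<circ> (\<lambda>(s, \<omega>). case_nat s \<omega>) \<in> noise \<Otimes>\<^sub>M paths \<rightarrow>\<^sub>M borel"
      by (rule measurable_comp[OF cn]) measurable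
  qed (simp_all, measurable)
  finally show ?thesis .
qed

section \<open>Uniqueness of the invariant law by characteristic functions\<close>

lemma char_distr_step:
  assumes "prob_space M" and [measurable]: "X \<in> borel_measurable M"
  shows "char (distr (noise \<Otimes>\<^sub>M M) borel (\<lambda>(s, x). s + \<alpha> * X x)) t =
    char noise t * char (distr M borel X) (\<alpha> * t)"
proof -
  interpret M: prob_space M by fact
  interpret pair_prob_space noise M ..
  let ?F = "\<lambda>(s, x). iexp (t * (s + \<alpha> * X x))"
  have int: "integrable (noise \<Otimes>\<^sub>M M) ?F"
    by (rule P.integrable_const_bound[where B = 1]) (auto simp: split_beta')
  have "char (distr (noise \<Otimes>\<^sub>M M) borel (\<lambda>(s, x). s + \<alpha> * X x)) t = integral\<^sup>L (noise \<Otimes>\<^sub>M M) ?F"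
    unfolding char_def by (subst integral_distr) (auto simp: split_beta')
  also have "\<dots> = (\<integral>s. (\<integral>x. ?F (s, x) \<partial>M) \<partial>noise)"
    by (rule integral_fst'[OF int, symmetric])
  also have "\<dots> = (\<integral>s. iexp (t * s) * (\<integral>x. iexp (\<alpha> * t * X x) \<partial>M) \<partial>noise)"
    by (intro Bochner_Integration.integral_cong refl)
      (simp add: distrib_left exp_add mult_ac flip: integral_mult_right_zero)
  also have "\<dots> = char noise t * char (distr M borel X) (\<alpha> * t)"
    by (simp add: char_def integral_distr)
  finally show ?thesis .
qed

text \<open>Translates the kernel form of invariance into one step of the recursion with independent
  noise, by Tonelli and a translation of Lebesgue measure.\<close>

lemma invariant_distr:
  assumes inv: "ar_invariant \<nu> \<alpha> \<pi>"
  shows "\<pi> = distr (noise \<Otimes>\<^sub>M \<pi>) borel (\<lambda>(s, x). s + \<alpha> * x)"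
proof -
  have s [measurable_cong]: "sets \<pi> = sets borel" and p: "prob_space \<pi>"
    using inv by (auto simp: ar_invariant_def)
  interpret \<pi>: prob_space \<pi> by fact
  interpret pair_prob_space noise \<pi> ..
  show ?thesis
  proof (rule measure_eqI)
    fix B assume "B \<in> sets \<pi>"
    then have B [measurable]: "B \<in> sets borel" by (simp add: s)
    have "emeasure (distr (noise \<Otimes>\<^sub>M \<pi>) borel (\<lambda>(s, x). s + \<alpha> * x)) B =
        (\<integral>\<^sup>+z. indicator B z \<partial>distr (noise \<Otimes>\<^sub>M \<pi>) borel (\<lambda>(s, x). s + \<alpha> * x))"
      by simp
    also have "\<dots> = (\<integral>\<^sup>+z. indicator B (fst z + \<alpha> * snd z) \<partial>(noise \<Otimes>\<^sub>M \<pi>))"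
      by (subst nn_integral_distr) (auto simp: split_beta')
    also have "\<dots> = (\<integral>\<^sup>+x. \<integral>\<^sup>+s. indicator B (s + \<alpha> * x) \<partial>noise \<partial>\<pi>)"
      by (subst nn_integral_snd[symmetric]) auto
    also have "\<dots> = (\<integral>\<^sup>+x. emeasure (ar_kernel \<nu> \<alpha> x) B \<partial>\<pi>)"
    proof (rule nn_integral_cong)
      fix x
      have "(\<integral>\<^sup>+s. indicator B (s + \<alpha> * x) \<partial>noise) =
          (\<integral>\<^sup>+s. ennreal (\<nu> s) * indicator B (s + \<alpha> * x) \<partial>lborel)"
        unfolding noise_def by (rule nn_integral_density) measurable
      also have "\<dots> = (\<integral>\<^sup>+s. ennreal (\<nu> (s - \<alpha> * x)) * indicator B s \<partial>lborel)"
        using nn_integral_real_affine[of "\<lambda>s. ennreal (\<nu> (s - \<alpha> * x)) * indicator B s" 1 "\<alpha> * x"]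
        by (simp add: add.commute)
      also have "\<dots> = emeasure (ar_kernel \<nu> \<alpha> x) B"
        by (simp add: ar_kernel_def emeasure_density)
      finally show "(\<integral>\<^sup>+s. indicator B (s + \<alpha> * x) \<partial>noise) = emeasure (ar_kernel \<nu> \<alpha> x) B" .
    qed
    also have "\<dots> = emeasure \<pi> B" using inv B by (simp add: ar_invariant_def)
    finally show "emeasure \<pi> B = emeasure (distr (noise \<Otimes>\<^sub>M \<pi>) borel (\<lambda>(s, x). s + \<alpha> * x)) B"
      by simp
  qed (simp add: s)
qed

text \<open>Both characteristic functions satisfy
  \<open>phi t = char noise t * phi (\<alpha> * t)\<close>. Their distance \<open>D\<close>
  therefore satisfies \<open>D t \<le> D (\<alpha> ^ n * t)\<close>, and the right side tends to
  \<open>D 0 = 0\<close> by continuity at 0.\<close>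

lemma invariant_eq_distr_path_sum:
  assumes \<alpha>: "\<bar>\<alpha>\<bar> < 1" and inv: "ar_invariant \<nu> \<alpha> \<pi>"
  shows "\<pi> = distr paths borel (path_sum \<alpha>)"
proof -
  let ?L = "distr paths borel (path_sum \<alpha>)"
  have s: "sets \<pi> = sets borel" and p: "prob_space \<pi>"
    using inv by (auto simp: ar_invariant_def)
  have \<pi>: "real_distribution \<pi>"
    using s p by (simp add: real_distribution_def real_distribution_axioms_def)
  have L: "real_distribution ?L"
    by (simp add: real_distribution_def real_distribution_axioms_def paths.prob_space_distr)
  interpret \<pi>: real_distribution \<pi> by (rule \<pi>)
  interpret L: real_distribution ?L by (rule L)
  interpret noise: real_distribution noise
    by (simp add: real_distribution_def real_distribution_axioms_def prob_space_noise)
  have id: "distr \<pi> borel (\<lambda>x. x) = \<pi>"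
    using s by (intro distr_id2) simp
  have step\<pi>: "char \<pi> t = char noise t * char \<pi> (\<alpha> * t)" for t
    using char_distr_step[OF p, of "\<lambda>x. x" \<alpha> t] invariant_distr[OF inv] id by simp
  have stepL: "char ?L t = char noise t * char ?L (\<alpha> * t)" for t
    using char_distr_step[OF prob_space_paths, of "path_sum \<alpha>" \<alpha> t] distr_path_sum[OF \<alpha>] by simp
  define D where "D t = cmod (char \<pi> t - char ?L t)" for t
  have D_step: "D t \<le> D (\<alpha> * t)" for t
  proof -
    have "D t = cmod (char noise t) * D (\<alpha> * t)"
      unfolding D_def by (subst step\<pi>, subst stepL) (simp flip: norm_mult add: right_diff_distrib)
    also have "\<dots> \<le> 1 * D (\<alpha> * t)"
      by (intro mult_right_mono noise.cmod_char_le_1) (simp add: D_def)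
    finally show ?thesis by simp
  qed
  have D_pow: "D t \<le> D (\<alpha> ^ n * t)" for n t
  proof (induction n)
    case (Suc n)
    also have "D (\<alpha> ^ n * t) \<le> D (\<alpha> * (\<alpha> ^ n * t))" by (rule D_step)
    finally show ?case by (simp add: mult.assoc)
  qed simp
  have "D t \<le> 0" for t
  proof -
    have "(\<lambda>n. \<alpha> ^ n * t) \<longlonglongrightarrow> 0 * t"
      using \<alpha> by (intro tendsto_mult LIMSEQ_power_zero tendsto_const) simp
    then have "(\<lambda>n. \<alpha> ^ n * t) \<longlonglongrightarrow> 0" by simp
    moreover have "isCont D 0"
      unfolding D_def using \<pi>.isCont_char L.isCont_char by (intro continuous_intros) auto
    ultimately have "(\<lambda>n. D (\<alpha> ^ n * t)) \<longlonglongrightarrow> D 0"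
      by (rule isCont_tendsto_compose[rotated])
    then have "D t \<le> D 0" using D_pow by (intro LIMSEQ_le_const) auto
    then show ?thesis by (simp add: D_def \<pi>.char_zero L.char_zero)
  qed
  then have "char \<pi> = char ?L"
    by (intro ext) (simp add: D_def)
  then show ?thesis by (rule Levy_uniqueness[OF \<pi> L])
qed

end

section \<open>Differentiating the mean along noise paths\<close>

lemma
  fixes F :: "'i \<Rightarrow> 'a \<Rightarrow> 'b::{banach, second_countable_topology}"
  assumes "\<And>i. i \<in> set L \<Longrightarrow> integrable M (F i)"
  shows integrable_sum_list: "integrable M (\<lambda>x. \<Sum>i\<leftarrow>L. F i x)"
    and integral_sum_list: "(\<integral>x. (\<Sum>i\<leftarrow>L. F i x) \<partial>M) = (\<Sum>i\<leftarrow>L. integral\<^sup>L M (F i))"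
proof -
  have "integrable M (\<lambda>x. \<Sum>i\<leftarrow>L. F i x) \<and>
      (\<integral>x. (\<Sum>i\<leftarrow>L. F i x) \<partial>M) = (\<Sum>i\<leftarrow>L. integral\<^sup>L M (F i))"
    using assms by (induction L) auto
  then show "integrable M (\<lambda>x. \<Sum>i\<leftarrow>L. F i x)"
    "(\<integral>x. (\<Sum>i\<leftarrow>L. F i x) \<partial>M) = (\<Sum>i\<leftarrow>L. integral\<^sup>L M (F i))" by auto
qed

lemma has_vector_derivative_sum_list:
  assumes "\<And>i. i \<in> set L \<Longrightarrow> (F i has_vector_derivative F' i) net"
  shows "((\<lambda>x. \<Sum>i\<leftarrow>L. F i x) has_vector_derivative (\<Sum>i\<leftarrow>L. F' i)) net"
  using assms by (induction L) (auto intro!: has_vector_derivative_add)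

context smooth_noise
begin

text \<open>Here the exponents add up: \<open>\<delta> + N = r\<close>, so the weight and at most
  \<open>N\<close> powers of the path size together are controlled by
  \<open>M powr r = 1 + path_moment r b \<omega>\<close>. The factor 2 absorbs the 1 in
  \<open>1 + |w|\<close>, since \<open>1 \<le> K * M\<close>.\<close>

lemma moment_bound:
  assumes "1 \<le> K" "0 < b" "b < 1" "summable (\<lambda>k. b ^ k * \<bar>\<omega> k\<bar> powr r)"
    and "\<bar>w\<bar> \<le> K * path_bound r b \<omega>" "m \<le> N"
  shows "(1 + \<bar>w\<bar>) powr \<delta> * path_bound r b \<omega> ^ m \<le> (2 * K) powr \<delta> * (1 + path_moment r b \<omega>)"
proof -
  let ?M = "path_bound r b \<omega>"
  have M: "1 \<le> ?M" by (rule path_bound_ge_1[OF r_ge_1 assms(2-4)])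
  have "1 * 1 \<le> K * ?M" using M assms(1) by (intro mult_mono) auto
  then have "1 + \<bar>w\<bar> \<le> (2 * K) * ?M" using assms(5) by simp
  then have "(1 + \<bar>w\<bar>) powr \<delta> \<le> ((2 * K) * ?M) powr \<delta>"
    using \<delta>_bounds by (intro powr_mono2) auto
  moreover have "?M ^ m \<le> ?M ^ N" using M assms(6) by (rule power_increasing[rotated])
  ultimately have "(1 + \<bar>w\<bar>) powr \<delta> * ?M ^ m \<le> ((2 * K) * ?M) powr \<delta> * ?M ^ N"
    using M by (intro mult_mono) auto
  also have "\<dots> = (2 * K) powr \<delta> * (?M powr \<delta> * ?M powr real N)"
    using M assms(1) by (simp add: powr_mult powr_realpow mult.assoc)
  also have "?M powr \<delta> * ?M powr real N = 1 + path_moment r b \<omega>"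
    using path_bound_powr[OF r_ge_1 assms(2-4)] by (simp add: powr_add[symmetric] \<delta>_def)
  finally show ?thesis .
qed

definition path_term :: "(real \<Rightarrow> complex) \<Rightarrow> nat list \<Rightarrow> real \<Rightarrow> (nat \<Rightarrow> real) \<Rightarrow> complex" where
  "path_term f l \<alpha> \<omega> = psi f (length l) (drift 0 \<alpha> \<omega>) * complex_of_real (drift_prod l \<alpha> \<omega>)"

definition mean_term :: "(real \<Rightarrow> complex) \<Rightarrow> nat list \<Rightarrow> real \<Rightarrow> complex" where
  "mean_term f l \<alpha> = (\<integral>\<omega>. path_term f l \<alpha> \<omega> \<partial>paths)"

text \<open>The \<open>j\<close>-th derivative in \<open>\<alpha>\<close> of the mean of
  \<open>f\<close> under the stationary law; \<open>invariant_integral\<close> identifies the case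
  \<open>j = 0\<close>.\<close>

definition mean_level :: "(real \<Rightarrow> complex) \<Rightarrow> nat \<Rightarrow> real \<Rightarrow> complex" where
  "mean_level f j \<alpha> = (\<Sum>l\<leftarrow>diff_level j. mean_term f l \<alpha>)"

lemma path_term_measurable:
  assumes "dominated K f" "length l \<le> N"
  shows "path_term f l \<alpha> \<in> borel_measurable paths"
proof -
  note psi_measurable[OF assms, measurable]
  show ?thesis unfolding path_term_def[abs_def] by measurable
qed

text \<open>The order of quantifiers matters: \<open>Q\<close> is fixed before the path, the
  parameter and the test function, which enters only through the factor \<open>K\<close>.\<close>

lemma path_term_bound:
  assumes a: "0 \<le> a" "a < b" "b < 1" and l: "length l \<le> N"
  shows "\<exists>Q\<ge>0. \<forall>\<omega> \<alpha> K f. summable (\<lambda>k. b ^ k * \<bar>\<omega> k\<bar> powr r) \<longrightarrow> \<bar>\<alpha>\<bar> \<le> a \<longrightarrow> dominated K f \<longrightarrow>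
    cmod (path_term f l \<alpha> \<omega>) \<le> K * (Q * (1 + path_moment r b \<omega>))"
proof -
  have b: "0 < b" using a by simp
  obtain P where P: "0 \<le> P" "\<And>\<omega> \<alpha>. summable (\<lambda>k. b ^ k * \<bar>\<omega> k\<bar> powr r) \<Longrightarrow> \<bar>\<alpha>\<bar> \<le> a \<Longrightarrow>
      \<bar>drift 0 \<alpha> \<omega>\<bar> \<le> P * path_bound r b \<omega>"
    using drift_bound[OF a r_ge_1, of 0] by blast
  obtain L where L: "0 \<le> L" "\<And>\<omega> \<alpha>. summable (\<lambda>k. b ^ k * \<bar>\<omega> k\<bar> powr r) \<Longrightarrow> \<bar>\<alpha>\<bar> \<le> a \<Longrightarrow>
      \<bar>drift_prod l \<alpha> \<omega>\<bar> \<le> L * path_bound r b \<omega> ^ length l"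
    using drift_prod_bound[OF a r_ge_1, of l] by blast
  let ?Q = "C * A * L * (2 * (P + 1)) powr \<delta>"
  show ?thesis
  proof (intro exI[of _ ?Q] conjI allI impI)
    show "0 \<le> ?Q" using C_nonneg A_nonneg L by simp
    fix \<omega> \<alpha> K f
    assume good: "summable (\<lambda>k. b ^ k * \<bar>\<omega> k\<bar> powr r)" and \<alpha>: "\<bar>\<alpha>\<bar> \<le> a" and f: "dominated K f"
    let ?M = "path_bound r b \<omega>" and ?w = "drift 0 \<alpha> \<omega>"
    have "\<bar>?w\<bar> \<le> P * ?M" by (rule P(2)[OF good \<alpha>])
    \<comment> \<open>\<open>moment_bound\<close> asks for a factor of at least 1, hence
      \<open>P + 1\<close> in place of \<open>P\<close>.\<close>
    also have "\<dots> \<le> (P + 1) * ?M"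
      using path_bound_ge_1[OF r_ge_1 b a(3) good] by (intro mult_right_mono) auto
    finally have w: "\<bar>?w\<bar> \<le> (P + 1) * ?M" .
    have "cmod (path_term f l \<alpha> \<omega>) = cmod (psi f (length l) ?w) * \<bar>drift_prod l \<alpha> \<omega>\<bar>"
      by (simp add: path_term_def norm_mult)
    also have "\<dots> \<le> (C * A * K * (1 + \<bar>?w\<bar>) powr \<delta>) * (L * ?M ^ length l)"
      using psi_bound[OF f, of "length l" ?w] l L(2)[OF good \<alpha>] C_nonneg A_nonneg dominated_nonneg[OF f]
      by (intro mult_mono) auto
    also have "\<dots> = C * A * K * L * ((1 + \<bar>?w\<bar>) powr \<delta> * ?M ^ length l)"
      by simp
    also have "\<dots> \<le> C * A * K * L * ((2 * (P + 1)) powr \<delta> * (1 + path_moment r b \<omega>))"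
      using moment_bound[OF _ b a(3) good w l] P C_nonneg A_nonneg dominated_nonneg[OF f] L
      by (intro mult_left_mono) auto
    finally show "cmod (path_term f l \<alpha> \<omega>) \<le> K * (?Q * (1 + path_moment r b \<omega>))"
      by (simp add: mult_ac)
  qed
qed

text \<open>Two radii: \<open>a\<close> leaves room to vary \<open>\<alpha>\<close>, and the gap
  from \<open>a\<close> to \<open>b\<close> is what \<open>drift_bound\<close> consumes.\<close>

lemma between:
  fixes \<alpha> :: real
  assumes "\<bar>\<alpha>\<bar> < 1"
  obtains a b where "\<bar>\<alpha>\<bar> < a" "0 \<le> a" "a < b" "0 < b" "b < 1"
proof -
  obtain a where "\<bar>\<alpha>\<bar> < a" "a < 1" using dense[OF assms] by blast
  moreover from this obtain b where "a < b" "b < 1" using dense by blast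
  ultimately show thesis using that[of a b] by linarith
qed

lemma integrable_path_moment_mult:
  assumes "0 < b" "b < 1"
  shows "integrable paths (\<lambda>\<omega>. Q * (1 + path_moment r b \<omega>))"
  using integrable_path_moment[OF assms]
  by (intro integrable_mult_right Bochner_Integration.integrable_add) auto

lemma mean_term_dominated:
  assumes \<alpha>: "\<bar>\<alpha>\<bar> < 1" and l: "length l \<le> N"
  shows "\<exists>w. integrable paths w \<and> (\<forall>K f. dominated K f \<longrightarrow> (AE \<omega> in paths. cmod (path_term f l \<alpha> \<omega>) \<le> K * w \<omega>))"
proof -
  obtain a b where ab: "\<bar>\<alpha>\<bar> < a" "0 \<le> a" "a < b" "0 < b" "b < 1" using between[OF \<alpha>] .
  obtain Q where Q: "\<And>\<omega> \<alpha> K f. summable (\<lambda>k. b ^ k * \<bar>\<omega> k\<bar> powr r) \<Longrightarrow> \<bar>\<alpha>\<bar> \<le> a \<Longrightarrow> dominated K f \<Longrightarrow>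
      cmod (path_term f l \<alpha> \<omega>) \<le> K * (Q * (1 + path_moment r b \<omega>))"
    using path_term_bound[OF ab(2,3,5) l] by blast
  show ?thesis
  proof (intro exI conjI allI impI)
    show "integrable paths (\<lambda>\<omega>. Q * (1 + path_moment r b \<omega>))"
      by (rule integrable_path_moment_mult[OF ab(4,5)])
    show "AE \<omega> in paths. cmod (path_term f l \<alpha> \<omega>) \<le> K * (Q * (1 + path_moment r b \<omega>))" if "dominated K f" for K f
      using AE_good[OF ab(4,5)] by eventually_elim (rule Q, use ab that in auto)
  qed
qed

lemma integrable_path_term:
  assumes f: "dominated K f" and \<alpha>: "\<bar>\<alpha>\<bar> < 1" and l: "length l \<le> N"
  shows "integrable paths (path_term f l \<alpha>)"
proof -
  obtain w where w: "integrable paths w" "AE \<omega> in paths. cmod (path_term f l \<alpha> \<omega>) \<le> K * w \<omega>"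
    using mean_term_dominated[OF \<alpha> l] f by blast
  show ?thesis
  proof (rule Bochner_Integration.integrable_bound[OF _ path_term_measurable[OF f l]])
    show "integrable paths (\<lambda>\<omega>. K * w \<omega>)" using w(1) by simp
    show "AE \<omega> in paths. cmod (path_term f l \<alpha> \<omega>) \<le> norm (K * w \<omega>)"
      using w(2) by eventually_elim simp
  qed
qed

text \<open>Chain rule for the factor \<open>psi\<close>, product rule for the rest. Lists in
  \<open>diff_list l\<close> have the length of \<open>l\<close> and so share its order of
  \<open>psi\<close>, while \<open>1 # l\<close> raises it by one.\<close>

lemma path_term_has_derivative:
  assumes f: "dominated K f" and l: "length l < N"
    and b: "0 < b" "b < 1" and good: "summable (\<lambda>k. b ^ k * \<bar>\<omega> k\<bar> powr r)" and \<alpha>: "\<bar>\<alpha>\<bar> < b"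
  shows "((\<lambda>\<alpha>. path_term f l \<alpha> \<omega>) has_vector_derivative
    (\<Sum>l'\<leftarrow>diff_step l. path_term f l' \<alpha> \<omega>)) (at \<alpha>)"
proof -
  have d0: "((\<lambda>\<alpha>. drift 0 \<alpha> \<omega>) has_vector_derivative drift 1 \<alpha> \<omega>) (at \<alpha>)"
    using drift_has_derivative[OF r_ge_1 b good \<alpha>, of 0]
    by (simp add: has_real_derivative_iff_has_vector_derivative)
  have p: "((\<lambda>\<alpha>. psi f (length l) (drift 0 \<alpha> \<omega>)) has_vector_derivative
      drift 1 \<alpha> \<omega> *\<^sub>R psi f (Suc (length l)) (drift 0 \<alpha> \<omega>)) (at \<alpha>)"
    using vector_diff_chain_at[OF d0 psi_has_derivative[OF f, of "length l"]] l by (simp add: o_def)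
  have q: "((\<lambda>\<alpha>. complex_of_real (drift_prod l \<alpha> \<omega>)) has_vector_derivative
      complex_of_real (\<Sum>l'\<leftarrow>diff_list l. drift_prod l' \<alpha> \<omega>)) (at \<alpha>)"
    using drift_prod_has_derivative[OF r_ge_1 b good \<alpha>, of l]
    by (intro has_vector_derivative_of_real) (simp add: has_real_derivative_iff_has_vector_derivative)
  have "complex_of_real (\<Sum>l'\<leftarrow>L. drift_prod l' \<alpha> \<omega>) = (\<Sum>l'\<leftarrow>L. complex_of_real (drift_prod l' \<alpha> \<omega>))" for L
    by (induction L) auto
  moreover have "psi f (length l) (drift 0 \<alpha> \<omega>) * (\<Sum>l'\<leftarrow>diff_list l. complex_of_real (drift_prod l' \<alpha> \<omega>)) =
      (\<Sum>l'\<leftarrow>diff_list l. path_term f l' \<alpha> \<omega>)"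
    unfolding sum_list_const_mult[symmetric]
    by (intro arg_cong[where f = sum_list] map_cong refl) (simp add: path_term_def length_diff_list)
  moreover have "path_term f (1 # l) \<alpha> \<omega> =
      (drift 1 \<alpha> \<omega> *\<^sub>R psi f (Suc (length l)) (drift 0 \<alpha> \<omega>)) * complex_of_real (drift_prod l \<alpha> \<omega>)"
    by (simp add: path_term_def drift_prod_def scaleR_conv_of_real)
  ultimately have eq: "(\<Sum>l'\<leftarrow>diff_step l. path_term f l' \<alpha> \<omega>) =
      psi f (length l) (drift 0 \<alpha> \<omega>) * complex_of_real (\<Sum>l'\<leftarrow>diff_list l. drift_prod l' \<alpha> \<omega>) +
      (drift 1 \<alpha> \<omega> *\<^sub>R psi f (Suc (length l)) (drift 0 \<alpha> \<omega>)) * complex_of_real (drift_prod l \<alpha> \<omega>)"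
    by (simp only: diff_step_def list.map sum_list.Cons add.commute)
  show ?thesis
    unfolding eq unfolding path_term_def by (rule has_vector_derivative_mult[OF p q])
qed

lemma mean_term_has_derivative:
  assumes f: "dominated K f" and \<alpha>: "\<bar>\<alpha>\<bar> < 1" and l: "length l < N"
  shows "(mean_term f l has_vector_derivative (\<Sum>l'\<leftarrow>diff_step l. mean_term f l' \<alpha>)) (at \<alpha>)"
proof -
  obtain a b where ab: "\<bar>\<alpha>\<bar> < a" "0 \<le> a" "a < b" "0 < b" "b < 1" using between[OF \<alpha>] .
  have len: "length l' \<le> N" if "l' \<in> set (diff_step l)" for l'
    using length_diff_step[OF that] l by simp
  have "\<forall>l'\<in>set (diff_step l). \<exists>Q. \<forall>\<omega> \<alpha> K f. summable (\<lambda>k. b ^ k * \<bar>\<omega> k\<bar> powr r) \<longrightarrow> \<bar>\<alpha>\<bar> \<le> a \<longrightarrow>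
    dominated K f \<longrightarrow> cmod (path_term f l' \<alpha> \<omega>) \<le> K * (Q * (1 + path_moment r b \<omega>))"
    using path_term_bound[OF ab(2,3,5) len] by fast
  from bchoice[OF this] obtain Q where "\<forall>l'\<in>set (diff_step l). \<forall>\<omega> \<alpha> K f.
      summable (\<lambda>k. b ^ k * \<bar>\<omega> k\<bar> powr r) \<longrightarrow> \<bar>\<alpha>\<bar> \<le> a \<longrightarrow> dominated K f \<longrightarrow>
      cmod (path_term f l' \<alpha> \<omega>) \<le> K * (Q l' * (1 + path_moment r b \<omega>))" ..
  then have Q: "\<And>l' \<omega> \<alpha> K f. l' \<in> set (diff_step l) \<Longrightarrow>
      summable (\<lambda>k. b ^ k * \<bar>\<omega> k\<bar> powr r) \<Longrightarrow> \<bar>\<alpha>\<bar> \<le> a \<Longrightarrow> dominated K f \<Longrightarrow>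
      cmod (path_term f l' \<alpha> \<omega>) \<le> K * (Q l' * (1 + path_moment r b \<omega>))"
    by blast
  have int: "integrable paths (path_term f l' t)" if "l' \<in> set (diff_step l)" "\<bar>t\<bar> < 1" for l' t
    by (rule integrable_path_term[OF f that(2) len[OF that(1)]])
  let ?w = "\<lambda>\<omega>. \<Sum>l'\<leftarrow>diff_step l. K * (Q l' * (1 + path_moment r b \<omega>))"
  have "(mean_term f l has_vector_derivative
      (\<integral>\<omega>. (\<Sum>l'\<leftarrow>diff_step l. path_term f l' \<alpha> \<omega>) \<partial>paths)) (at \<alpha>)"
    unfolding mean_term_def[abs_def]
  \<comment> \<open>The radius \<open>a - |\<alpha>|\<close> keeps every \<open>t\<close> in the
    region \<open>|t| \<le> a\<close>, where the constants \<open>Q\<close> are valid, and below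
    \<open>b\<close>, where the power series may be differentiated.\<close>
  proof (rule has_vector_derivative_integral_dominated[where e = "a - \<bar>\<alpha>\<bar>" and w = ?w])
    show "integrable paths (path_term f l t)" if "\<bar>t - \<alpha>\<bar> < a - \<bar>\<alpha>\<bar>" for t
      using that ab l by (intro integrable_path_term[OF f]) auto
    show "(\<lambda>\<omega>. \<Sum>l'\<leftarrow>diff_step l. path_term f l' \<alpha> \<omega>) \<in> borel_measurable paths"
      using integrable_sum_list[of "diff_step l" paths "\<lambda>l'. path_term f l' \<alpha>"] int \<alpha> by auto
    show "integrable paths ?w"
      by (intro integrable_sum_list integrable_mult_right integrable_path_moment_mult ab)
    show "AE \<omega> in paths. \<forall>t. \<bar>t - \<alpha>\<bar> < a - \<bar>\<alpha>\<bar> \<longrightarrow>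
        ((\<lambda>t. path_term f l t \<omega>) has_vector_derivative (\<Sum>l'\<leftarrow>diff_step l. path_term f l' t \<omega>)) (at t) \<and>
        cmod (\<Sum>l'\<leftarrow>diff_step l. path_term f l' t \<omega>) \<le> ?w \<omega>"
      using AE_good[OF ab(4,5)]
    proof eventually_elim
      case (elim \<omega>)
      show ?case
      proof (intro allI impI conjI)
        fix t assume "\<bar>t - \<alpha>\<bar> < a - \<bar>\<alpha>\<bar>"
        then have t: "\<bar>t\<bar> \<le> a" "\<bar>t\<bar> < b" using ab by auto
        show "((\<lambda>t. path_term f l t \<omega>) has_vector_derivative (\<Sum>l'\<leftarrow>diff_step l. path_term f l' t \<omega>)) (at t)"
          by (rule path_term_has_derivative[OF f l ab(4,5) elim t(2)])
        have "cmod (\<Sum>l'\<leftarrow>L. path_term f l' t \<omega>) \<le> (\<Sum>l'\<leftarrow>L. K * (Q l' * (1 + path_moment r b \<omega>)))"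
          if "set L \<subseteq> set (diff_step l)" for L
          using that
        proof (induction L)
          case (Cons l' L)
          then show ?case
            using Q[OF _ elim t(1) f, of l']
            by (auto intro!: order_trans[OF norm_triangle_ineq] add_mono)
        qed simp
        then show "cmod (\<Sum>l'\<leftarrow>diff_step l. path_term f l' t \<omega>) \<le> ?w \<omega>" by simp
      qed
    qed
  qed (use ab in simp)
  also have "(\<integral>\<omega>. (\<Sum>l'\<leftarrow>diff_step l. path_term f l' \<alpha> \<omega>) \<partial>paths) =
      (\<Sum>l'\<leftarrow>diff_step l. mean_term f l' \<alpha>)"
    unfolding mean_term_def using int \<alpha> by (intro integral_sum_list) auto
  finally show ?thesis .
qed

text \<open>\<open>R\<close> tends to 0 along almost every path, but for \<open>length l = N\<close>
  it is of order \<open>r + 1\<close> in the noise, beyond the available moment; \<open>w\<close> is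
  integrable but does not depend on \<open>t\<close>. Their minimum combines both virtues, and
  dominated convergence gives a modulus \<open>g\<close> that does not involve
  \<open>f\<close>.\<close>

lemma mean_term_continuous:
  assumes \<alpha>: "\<bar>\<alpha>\<bar> < 1" and l: "length l \<le> N"
  shows "\<exists>g. (g \<longlongrightarrow> 0) (at \<alpha>) \<and>
    (\<forall>\<^sub>F t in at \<alpha>. \<forall>K f. dominated K f \<longrightarrow> cmod (mean_term f l t - mean_term f l \<alpha>) \<le> K * g t)"
proof -
  obtain a b where ab: "\<bar>\<alpha>\<bar> < a" "0 \<le> a" "a < b" "0 < b" "b < 1" using between[OF \<alpha>] .
  obtain Q where Q: "0 \<le> Q" "\<And>\<omega> \<alpha> K f. summable (\<lambda>k. b ^ k * \<bar>\<omega> k\<bar> powr r) \<Longrightarrow> \<bar>\<alpha>\<bar> \<le> a \<Longrightarrow> dominated K f \<Longrightarrow>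
      cmod (path_term f l \<alpha> \<omega>) \<le> K * (Q * (1 + path_moment r b \<omega>))"
    using path_term_bound[OF ab(2,3,5) l] by blast
  \<comment> \<open>The increment is split as for a product: the increment of \<open>psi\<close>, by
    its Lipschitz bound, times the new \<open>drift_prod\<close>, plus the old \<open>psi\<close>
    times the increment of \<open>drift_prod\<close>. The factor \<open>K\<close> is left
    out.\<close>
  define R where "R t \<omega> = C * A * (1 + \<bar>drift 0 t \<omega>\<bar> + \<bar>drift 0 \<alpha> \<omega>\<bar>) powr \<delta> *
      \<bar>drift 0 t \<omega> - drift 0 \<alpha> \<omega>\<bar> * \<bar>drift_prod l t \<omega>\<bar> +
      C * A * (1 + \<bar>drift 0 \<alpha> \<omega>\<bar>) powr \<delta> * \<bar>drift_prod l t \<omega> - drift_prod l \<alpha> \<omega>\<bar>" for t \<omega>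
  define w where "w \<omega> = 2 * Q * (1 + path_moment r b \<omega>)" for \<omega>
  have w_int: "integrable paths w"
    unfolding w_def by (rule integrable_path_moment_mult[OF ab(4,5)])
  have R_meas [measurable]: "R t \<in> borel_measurable paths" for t
    unfolding R_def[abs_def] by measurable
  have w_meas [measurable]: "w \<in> borel_measurable paths" using w_int by simp
  have R_nonneg: "0 \<le> R t \<omega>" for t \<omega>
    unfolding R_def using C_nonneg A_nonneg by simp
  have w_nonneg: "AE \<omega> in paths. 0 \<le> w \<omega>"
    using AE_good[OF ab(4,5)]
    by eventually_elim (use Q(1) path_moment_nonneg[OF r_ge_1 ab(4,5)] in \<open>simp add: w_def\<close>)
  have R_bound: "cmod (path_term f l t \<omega> - path_term f l \<alpha> \<omega>) \<le> K * R t \<omega>" if f: "dominated K f" for K f t \<omega>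
  proof -
    let ?v = "drift 0 t \<omega>" and ?w = "drift 0 \<alpha> \<omega>"
    have eq: "path_term f l t \<omega> - path_term f l \<alpha> \<omega> =
        (psi f (length l) ?v - psi f (length l) ?w) * complex_of_real (drift_prod l t \<omega>) +
        psi f (length l) ?w * complex_of_real (drift_prod l t \<omega> - drift_prod l \<alpha> \<omega>)"
      by (simp add: path_term_def algebra_simps)
    have "cmod (path_term f l t \<omega> - path_term f l \<alpha> \<omega>) \<le>
        cmod (psi f (length l) ?v - psi f (length l) ?w) * \<bar>drift_prod l t \<omega>\<bar> +
        cmod (psi f (length l) ?w) * \<bar>drift_prod l t \<omega> - drift_prod l \<alpha> \<omega>\<bar>"
      unfolding eq by (rule order_trans[OF norm_triangle_ineq]) (simp only: norm_mult norm_of_real order_refl)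
    also have "\<dots> \<le> C * A * K * (1 + \<bar>?v\<bar> + \<bar>?w\<bar>) powr \<delta> * \<bar>?v - ?w\<bar> * \<bar>drift_prod l t \<omega>\<bar> +
        C * A * K * (1 + \<bar>?w\<bar>) powr \<delta> * \<bar>drift_prod l t \<omega> - drift_prod l \<alpha> \<omega>\<bar>"
      using psi_lipschitz[OF f l, of ?v ?w] psi_bound[OF f, of "length l" ?w] l
      by (intro add_mono mult_right_mono) auto
    finally show ?thesis by (simp add: R_def algebra_simps)
  qed
  define g where "g t = (\<integral>\<omega>. min (R t \<omega>) (w \<omega>) \<partial>paths)" for t
  have min_int: "integrable paths (\<lambda>\<omega>. min (R t \<omega>) (w \<omega>))" for t
  proof (rule Bochner_Integration.integrable_bound[OF w_int])
    show "AE \<omega> in paths. norm (min (R t \<omega>) (w \<omega>)) \<le> norm (w \<omega>)"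
      using w_nonneg by eventually_elim (use R_nonneg in \<open>auto simp: min_def\<close>)
  qed measurable
  show ?thesis
  proof (intro exI[of _ g] conjI)
    have "((\<lambda>t. \<integral>\<omega>. min (R t \<omega>) (w \<omega>) \<partial>paths) \<longlongrightarrow> (\<integral>\<omega>. 0 \<partial>paths)) (at \<alpha>)"
    proof (rule tendsto_integral_dominated_at[OF _ _ w_int])
      show "AE \<omega> in paths. ((\<lambda>t. min (R t \<omega>) (w \<omega>)) \<longlongrightarrow> 0) (at \<alpha>)"
        using AE_good[OF ab(4,5)] w_nonneg
      proof eventually_elim
        case (elim \<omega>)
        have \<alpha>b: "\<bar>\<alpha>\<bar> < b" using ab by simp
        have c0: "((\<lambda>t. drift 0 t \<omega>) \<longlongrightarrow> drift 0 \<alpha> \<omega>) (at \<alpha>)"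
          using DERIV_isCont[OF drift_has_derivative[OF r_ge_1 ab(4,5) elim(1) \<alpha>b]] by (simp add: isCont_def)
        have c1: "((\<lambda>t. drift_prod l t \<omega>) \<longlongrightarrow> drift_prod l \<alpha> \<omega>) (at \<alpha>)"
          using DERIV_isCont[OF drift_prod_has_derivative[OF r_ge_1 ab(4,5) elim(1) \<alpha>b]] by (simp add: isCont_def)
        have "((\<lambda>t. R t \<omega>) \<longlongrightarrow> C * A * (1 + \<bar>drift 0 \<alpha> \<omega>\<bar> + \<bar>drift 0 \<alpha> \<omega>\<bar>) powr \<delta> *
            \<bar>drift 0 \<alpha> \<omega> - drift 0 \<alpha> \<omega>\<bar> * \<bar>drift_prod l \<alpha> \<omega>\<bar> +
            C * A * (1 + \<bar>drift 0 \<alpha> \<omega>\<bar>) powr \<delta> * \<bar>drift_prod l \<alpha> \<omega> - drift_prod l \<alpha> \<omega>\<bar>) (at \<alpha>)"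
          unfolding R_def by (intro tendsto_intros c0 c1) auto
        then have "((\<lambda>t. R t \<omega>) \<longlongrightarrow> 0) (at \<alpha>)" by simp
        from tendsto_min[OF this tendsto_const, of "w \<omega>"] elim(2)
        show ?case by simp
      qed
      show "\<forall>\<^sub>F t in at \<alpha>. AE \<omega> in paths. norm (min (R t \<omega>) (w \<omega>)) \<le> w \<omega>"
      proof (rule always_eventually, rule allI)
        fix t
        show "AE \<omega> in paths. norm (min (R t \<omega>) (w \<omega>)) \<le> w \<omega>"
          using w_nonneg by eventually_elim (use R_nonneg in \<open>auto simp: min_def\<close>)
      qed
    qed auto
    then show "(g \<longlongrightarrow> 0) (at \<alpha>)" by (simp add: g_def[abs_def])
    have "\<forall>\<^sub>F t in at \<alpha>. \<bar>t\<bar> \<le> a"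
      using ab by (auto simp: eventually_at dist_real_def intro!: exI[of _ "a - \<bar>\<alpha>\<bar>"])
    then show "\<forall>\<^sub>F t in at \<alpha>. \<forall>K f. dominated K f \<longrightarrow> cmod (mean_term f l t - mean_term f l \<alpha>) \<le> K * g t"
    proof eventually_elim
      case (elim t)
      show ?case
      proof (intro allI impI)
        fix K f assume f: "dominated K f"
        have i: "integrable paths (path_term f l t)" "integrable paths (path_term f l \<alpha>)"
          using elim ab by (intro integrable_path_term[OF f _ l]; simp)+
        have "cmod (mean_term f l t - mean_term f l \<alpha>) =
            cmod (\<integral>\<omega>. (path_term f l t \<omega> - path_term f l \<alpha> \<omega>) \<partial>paths)"
          using i by (simp add: mean_term_def)
        also have "\<dots> \<le> (\<integral>\<omega>. cmod (path_term f l t \<omega> - path_term f l \<alpha> \<omega>) \<partial>paths)"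
          by (rule integral_norm_bound)
        also have "\<dots> \<le> (\<integral>\<omega>. K * min (R t \<omega>) (w \<omega>) \<partial>paths)"
        proof (rule integral_mono_AE)
          show "AE \<omega> in paths. cmod (path_term f l t \<omega> - path_term f l \<alpha> \<omega>) \<le> K * min (R t \<omega>) (w \<omega>)"
            using AE_good[OF ab(4,5)]
          proof eventually_elim
            case (elim \<omega>)
            have "cmod (path_term f l t \<omega> - path_term f l \<alpha> \<omega>) \<le>
                cmod (path_term f l t \<omega>) + cmod (path_term f l \<alpha> \<omega>)"
              by (rule norm_triangle_ineq4)
            also have "\<dots> \<le> K * w \<omega>"
              using Q(2)[OF elim _ f, of t] Q(2)[OF elim _ f, of \<alpha>] \<open>\<bar>t\<bar> \<le> a\<close> ab
              by (simp add: w_def)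
            finally show ?case using R_bound[OF f, of t \<omega>] by (simp add: min_def)
          qed
        qed (use i min_int in auto)
        also have "\<dots> = K * g t" by (simp add: g_def)
        finally show "cmod (mean_term f l t - mean_term f l \<alpha>) \<le> K * g t" .
      qed
    qed
  qed
qed

section \<open>From single terms to derivatives of order \<open>j\<close>\<close>

lemma mean_level_has_derivative:
  assumes f: "dominated K f" and \<alpha>: "\<bar>\<alpha>\<bar> < 1" and j: "j < N"
  shows "(mean_level f j has_vector_derivative mean_level f (Suc j) \<alpha>) (at \<alpha>)"
proof -
  have "((\<lambda>t. \<Sum>l\<leftarrow>diff_level j. mean_term f l t) has_vector_derivative
      (\<Sum>l\<leftarrow>diff_level j. \<Sum>l'\<leftarrow>diff_step l. mean_term f l' \<alpha>)) (at \<alpha>)"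
    using j length_diff_level[of _ j] by (intro has_vector_derivative_sum_list mean_term_has_derivative[OF f \<alpha>]) force
  moreover have "(\<Sum>l\<leftarrow>L. \<Sum>l'\<leftarrow>diff_step l. mean_term f l' \<alpha>) =
      (\<Sum>l\<leftarrow>concat (map diff_step L). mean_term f l \<alpha>)" for L
    by (induction L) auto
  ultimately show ?thesis by (simp add: mean_level_def[abs_def])
qed

lemma mean_level_continuous:
  assumes \<alpha>: "\<bar>\<alpha>\<bar> < 1" and j: "j \<le> N"
  shows "\<exists>g. (g \<longlongrightarrow> 0) (at \<alpha>) \<and>
    (\<forall>\<^sub>F t in at \<alpha>. \<forall>K f. dominated K f \<longrightarrow> cmod (mean_level f j t - mean_level f j \<alpha>) \<le> K * g t)"
proof -
  have "\<exists>g. (g \<longlongrightarrow> 0) (at \<alpha>) \<and> (\<forall>\<^sub>F t in at \<alpha>. \<forall>K f. dominated K f \<longrightarrow>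
      cmod ((\<Sum>l\<leftarrow>L. mean_term f l t) - (\<Sum>l\<leftarrow>L. mean_term f l \<alpha>)) \<le> K * g t)"
    if "\<And>l. l \<in> set L \<Longrightarrow> length l \<le> N" for L
    using that
  proof (induction L)
    case Nil
    show ?case by (intro exI[of _ "\<lambda>_. 0"]) simp
  next
    case (Cons l L)
    obtain g where g: "(g \<longlongrightarrow> 0) (at \<alpha>)" "\<forall>\<^sub>F t in at \<alpha>. \<forall>K f. dominated K f \<longrightarrow>
        cmod ((\<Sum>l\<leftarrow>L. mean_term f l t) - (\<Sum>l\<leftarrow>L. mean_term f l \<alpha>)) \<le> K * g t"
      using Cons by auto
    obtain h where h: "(h \<longlongrightarrow> 0) (at \<alpha>)" "\<forall>\<^sub>F t in at \<alpha>. \<forall>K f. dominated K f \<longrightarrow>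
        cmod (mean_term f l t - mean_term f l \<alpha>) \<le> K * h t"
      using mean_term_continuous[OF \<alpha>, of l] Cons.prems by auto
    show ?case
    proof (intro exI[of _ "\<lambda>t. h t + g t"] conjI)
      show "((\<lambda>t. h t + g t) \<longlongrightarrow> 0) (at \<alpha>)" using tendsto_add[OF h(1) g(1)] by simp
      show "\<forall>\<^sub>F t in at \<alpha>. \<forall>K f. dominated K f \<longrightarrow>
        cmod ((\<Sum>l\<leftarrow>l # L. mean_term f l t) - (\<Sum>l\<leftarrow>l # L. mean_term f l \<alpha>)) \<le> K * (h t + g t)"
        using g(2) h(2)
      proof eventually_elim
        case (elim t)
        show ?case
        proof (intro allI impI)
          fix K f assume f: "dominated K f"
          have "cmod ((mean_term f l t - mean_term f l \<alpha>) +
              ((\<Sum>l\<leftarrow>L. mean_term f l t) - (\<Sum>l\<leftarrow>L. mean_term f l \<alpha>))) \<le> K * h t + K * g t"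
            using elim f by (intro order_trans[OF norm_triangle_ineq] add_mono) auto
          then show "cmod ((\<Sum>l\<leftarrow>l # L. mean_term f l t) - (\<Sum>l\<leftarrow>l # L. mean_term f l \<alpha>)) \<le> K * (h t + g t)"
            by (simp add: algebra_simps)
        qed
      qed
    qed
  qed
  from this[of "diff_level j"] j length_diff_level[of _ j] show ?thesis
    unfolding mean_level_def by force
qed

end

section \<open>Regularity in the dual of the weighted space\<close>

lemma zero_in_wspace: "(\<lambda>x. 0) \<in> wspace r \<beta>" and wnorm_zero: "wnorm r \<beta> (\<lambda>x. 0) = 0"
  by (simp_all add: wspace_def wnorm_def image_constant_conv)

text \<open>The dual norm is a supremum of reals, informative only once a bound on the unit ball is
  known. The zero function makes the ball nonempty and gives the lower bound.\<close>

lemma wdual_norm_bounds: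
  assumes "\<And>f. f \<in> wspace r \<beta> \<Longrightarrow> wnorm r \<beta> f \<le> 1 \<Longrightarrow> cmod (\<phi> f) \<le> e"
  shows "0 \<le> wdual_norm r \<beta> \<phi>" "wdual_norm r \<beta> \<phi> \<le> e"
proof -
  let ?B = "{f \<in> wspace r \<beta>. wnorm r \<beta> f \<le> 1}"
  have 0: "(\<lambda>x. 0) \<in> ?B" by (simp add: zero_in_wspace wnorm_zero)
  have bdd: "bdd_above ((\<lambda>f. cmod (\<phi> f)) ` ?B)" using assms by (intro bdd_aboveI[of _ e]) auto
  show "wdual_norm r \<beta> \<phi> \<le> e"
    unfolding wdual_norm_def by (rule cSUP_least) (use 0 assms in blast)+
  have "cmod (\<phi> (\<lambda>x. 0)) \<le> wdual_norm r \<beta> \<phi>"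
    unfolding wdual_norm_def by (rule cSUP_upper[OF 0 bdd])
  then show "0 \<le> wdual_norm r \<beta> \<phi>" by (rule order_trans[OF norm_ge_zero])
qed

lemma wdual_norm_tendsto_0:
  assumes "\<And>e. 0 < e \<Longrightarrow>
    \<forall>\<^sub>F h in F. \<forall>f. f \<in> wspace r \<beta> \<longrightarrow> wnorm r \<beta> f \<le> 1 \<longrightarrow> cmod (\<Phi> h f) \<le> e"
  shows "((\<lambda>h. wdual_norm r \<beta> (\<Phi> h)) \<longlongrightarrow> 0) F"
proof (rule tendstoI)
  fix e :: real assume "0 < e"
  then have "0 < e / 2" by simp
  from assms[OF this] show "\<forall>\<^sub>F h in F. dist (wdual_norm r \<beta> (\<Phi> h)) 0 < e"
  proof eventually_elim
    case (elim h)
    then have "0 \<le> wdual_norm r \<beta> (\<Phi> h)" "wdual_norm r \<beta> (\<Phi> h) \<le> e / 2"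
      by (intro wdual_norm_bounds; blast)+
    then show ?case using \<open>0 < e\<close> by simp
  qed
qed

lemma tendsto_SUP_ereal_0:
  fixes R :: "real \<Rightarrow> 'a \<Rightarrow> real"
  assumes "S \<noteq> {}" and "\<And>e. 0 < e \<Longrightarrow> \<forall>\<^sub>F \<epsilon> in F. \<forall>x\<in>S. \<bar>R \<epsilon> x\<bar> \<le> e"
  shows "((\<lambda>\<epsilon>. SUP x\<in>S. ereal \<bar>R \<epsilon> x\<bar>) \<longlongrightarrow> 0) F"
proof (rule order_tendstoI)
  fix a :: ereal assume a: "a < 0"
  obtain x where x: "x \<in> S" using assms(1) by blast
  have "a < (SUP x\<in>S. ereal \<bar>R \<epsilon> x\<bar>)" for \<epsilon>
    by (rule less_le_trans[OF a]) (rule SUP_upper2[OF x], simp)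
  then show "\<forall>\<^sub>F \<epsilon> in F. a < (SUP x\<in>S. ereal \<bar>R \<epsilon> x\<bar>)" by simp
next
  fix a :: ereal assume "0 < a"
  then obtain e where e: "0 < ereal e" "ereal e < a" using ereal_dense2 by blast
  then have "0 < e" by simp
  from assms(2)[OF this] show "\<forall>\<^sub>F \<epsilon> in F. (SUP x\<in>S. ereal \<bar>R \<epsilon> x\<bar>) < a"
  proof eventually_elim
    case (elim \<epsilon>)
    then have "(SUP x\<in>S. ereal \<bar>R \<epsilon> x\<bar>) \<le> ereal e" by (intro SUP_least) simp
    then show ?case using e(2) by (rule le_less_trans)
  qed
qed

context smooth_noise
begin

definition \<beta> :: real where "\<beta> = \<delta> / r"

lemma wspace_dominated: "f \<in> wspace r \<beta> \<Longrightarrow> dominated (wnorm r \<beta> f) f"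
  using wspace_bound[of f r \<beta>] r_ge_1 by (auto simp: dominated_def wspace_measurable \<beta>_def)

section \<open>Linearity, boundedness and bounded convergence of the derivatives as
  functionals\<close>

lemma dominated_mono: "dominated K f \<Longrightarrow> K \<le> L \<Longrightarrow> dominated L f"
  unfolding dominated_def by (meson mult_right_mono order_trans powr_ge_zero)

text \<open>Brings indicators into the unit class, so that what is uniform in \<open>f\<close> is
  uniform over Borel sets.\<close>

lemma dominated_one:
  assumes "f \<in> borel_measurable borel" "\<And>x. cmod (f x) \<le> 1"
  shows "dominated 1 f"
  unfolding dominated_def
proof (intro conjI allI assms)
  fix x :: real
  have "1 \<le> (1 + \<bar>x\<bar>) powr \<delta>" using \<delta>_bounds by (intro ge_one_powr_ge_zero) auto
  then show "cmod (f x) \<le> 1 * (1 + \<bar>x\<bar>) powr \<delta>" using assms(2)[of x] by simp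
qed

lemma dominated_add: "dominated K f \<Longrightarrow> dominated L g \<Longrightarrow> dominated (K + L) (\<lambda>x. f x + g x)"
  unfolding dominated_def by (auto simp: distrib_right intro!: order_trans[OF norm_triangle_ineq] add_mono)

lemma dominated_mult: "dominated K f \<Longrightarrow> dominated (cmod c * K) (\<lambda>x. c * f x)"
  unfolding dominated_def by (auto simp: norm_mult mult.assoc intro: mult_left_mono)

lemma mean_term_add:
  assumes f: "dominated K f" and g: "dominated L g" and \<alpha>: "\<bar>\<alpha>\<bar> < 1" and l: "length l \<le> N"
  shows "mean_term (\<lambda>x. f x + g x) l \<alpha> = mean_term f l \<alpha> + mean_term g l \<alpha>"
proof -
  have "path_term (\<lambda>x. f x + g x) l \<alpha> \<omega> = path_term f l \<alpha> \<omega> + path_term g l \<alpha> \<omega>" for \<omega>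
    using integrable_psi[OF f, of "length l"] integrable_psi[OF g, of "length l"] l
    by (simp add: path_term_def psi_def distrib_right del: of_real_mult)
  then show ?thesis
    using integrable_path_term[OF f \<alpha> l] integrable_path_term[OF g \<alpha> l]
    by (simp add: mean_term_def)
qed

text \<open>Scalars pass through a Bochner integral unconditionally, a non-integrable integrand
  having integral 0; the identity thus holds for every \<open>f\<close>.\<close>

lemma mean_term_mult: "mean_term (\<lambda>x. c * f x) l \<alpha> = c * mean_term f l \<alpha>"
proof -
  have "path_term (\<lambda>x. c * f x) l \<alpha> \<omega> = c * path_term f l \<alpha> \<omega>" for \<omega>
    by (simp add: path_term_def psi_def mult.assoc del: of_real_mult)
  then show ?thesis by (simp add: mean_term_def)
qed

lemma mean_level_add:
  assumes "dominated K f" "dominated L g" "\<bar>\<alpha>\<bar> < 1" "j \<le> N"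
  shows "mean_level (\<lambda>x. f x + g x) j \<alpha> = mean_level f j \<alpha> + mean_level g j \<alpha>"
proof -
  have "mean_level (\<lambda>x. f x + g x) j \<alpha> = (\<Sum>l\<leftarrow>diff_level j. mean_term f l \<alpha> + mean_term g l \<alpha>)"
    unfolding mean_level_def using length_diff_level[of _ j] assms
    by (intro arg_cong[where f = sum_list] map_cong refl mean_term_add) force+
  then show ?thesis by (simp add: mean_level_def sum_list_addf)
qed

lemma mean_level_mult: "mean_level (\<lambda>x. c * f x) j \<alpha> = c * mean_level f j \<alpha>"
  by (simp add: mean_level_def mean_term_mult sum_list_const_mult)

text \<open>\<open>B\<close> adds up the integrals of majorants chosen before \<open>f\<close>; it
  bounds the derivative as a functional.\<close>

lemma mean_level_bound:
  assumes \<alpha>: "\<bar>\<alpha>\<bar> < 1" and j: "j \<le> N"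
  shows "\<exists>B. \<forall>K f. dominated K f \<longrightarrow> cmod (mean_level f j \<alpha>) \<le> B * K"
proof -
  have "\<exists>B. \<forall>K f. dominated K f \<longrightarrow> cmod (\<Sum>l\<leftarrow>L. mean_term f l \<alpha>) \<le> B * K"
    if "\<And>l. l \<in> set L \<Longrightarrow> length l \<le> N" for L
    using that
  proof (induction L)
    case Nil
    show ?case by (intro exI[of _ 0]) simp
  next
    case (Cons l L)
    then obtain B where B: "\<And>K f. dominated K f \<Longrightarrow> cmod (\<Sum>l\<leftarrow>L. mean_term f l \<alpha>) \<le> B * K" by auto
    have l: "length l \<le> N" using Cons.prems by simp
    obtain w where w: "integrable paths w"
        "\<And>K f. dominated K f \<Longrightarrow> AE \<omega> in paths. cmod (path_term f l \<alpha> \<omega>) \<le> K * w \<omega>"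
      using mean_term_dominated[OF \<alpha> l] by blast
    have "cmod (mean_term f l \<alpha>) \<le> K * integral\<^sup>L paths w" if f: "dominated K f" for K f
    proof -
      have "cmod (mean_term f l \<alpha>) \<le> (\<integral>\<omega>. cmod (path_term f l \<alpha> \<omega>) \<partial>paths)"
        unfolding mean_term_def by (rule integral_norm_bound)
      also have "\<dots> \<le> (\<integral>\<omega>. K * w \<omega> \<partial>paths)"
        using integrable_path_term[OF f \<alpha> l] w f by (intro integral_mono_AE) auto
      finally have "cmod (mean_term f l \<alpha>) \<le> (\<integral>\<omega>. K * w \<omega> \<partial>paths)" .
      then show ?thesis by simp
    qed
    then have "cmod (\<Sum>l\<leftarrow>l # L. mean_term f l \<alpha>) \<le> K * integral\<^sup>L paths w + B * K" if "dominated K f" for K f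
      using B that by (auto intro!: order_trans[OF norm_triangle_ineq] add_mono)
    then show ?case
      by (intro exI[of _ "integral\<^sup>L paths w + B"]) (simp add: algebra_simps)
  qed
  from this[of "diff_level j"] j length_diff_level[of _ j] show ?thesis
    unfolding mean_level_def by force
qed

text \<open>Dominated convergence twice, in the integral over \<open>y\<close> inside
  \<open>psi\<close> and then over the paths. It provides the countable additivity of the signed
  measures.\<close>

lemma mean_term_tendsto:
  assumes F: "\<And>n. dominated K (F n)" and lim: "\<And>x. (\<lambda>n. F n x) \<longlonglongrightarrow> f x" and f: "dominated K f"
    and \<alpha>: "\<bar>\<alpha>\<bar> < 1" and l: "length l \<le> N"
  shows "(\<lambda>n. mean_term (F n) l \<alpha>) \<longlonglongrightarrow> mean_term f l \<alpha>"
proof -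
  obtain w where w: "integrable paths w"
      "\<And>f. dominated K f \<Longrightarrow> AE \<omega> in paths. cmod (path_term f l \<alpha> \<omega>) \<le> K * w \<omega>"
    using mean_term_dominated[OF \<alpha> l] by blast
  have psi: "(\<lambda>n. psi (F n) (length l) v) \<longlonglongrightarrow> psi f (length l) v" for v
    unfolding psi_def
  proof (rule integral_dominated_convergence[where w = "\<lambda>y. C * K * ((1 + \<bar>y\<bar>) powr \<delta> * \<nu> (y - v))"])
    show "integrable lborel (\<lambda>y. C * K * ((1 + \<bar>y\<bar>) powr \<delta> * \<nu> (y - v)))"
      using integrable_weight_shift by (intro integrable_mult_right)
    show "AE y in lborel. (\<lambda>n. F n y * complex_of_real ((- 1) ^ length l * (deriv ^^ length l) \<nu> (y - v)))
        \<longlonglongrightarrow> f y * complex_of_real ((- 1) ^ length l * (deriv ^^ length l) \<nu> (y - v))"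
      by (intro AE_I2 tendsto_mult_right lim)
    show "AE y in lborel. cmod (F n y * complex_of_real ((- 1) ^ length l * (deriv ^^ length l) \<nu> (y - v)))
        \<le> C * K * ((1 + \<bar>y\<bar>) powr \<delta> * \<nu> (y - v))" for n
      using psi_integrand_bound[OF F, of "length l"] l by (intro AE_I2) simp
    show "(\<lambda>y. f y * complex_of_real ((- 1) ^ length l * (deriv ^^ length l) \<nu> (y - v))) \<in> borel_measurable lborel"
      using integrable_psi[OF f, of "length l"] l by auto
    show "(\<lambda>y. F n y * complex_of_real ((- 1) ^ length l * (deriv ^^ length l) \<nu> (y - v))) \<in> borel_measurable lborel" for n
      using integrable_psi[OF F, of "length l"] l by auto
  qed
  show ?thesis
    unfolding mean_term_def
  proof (rule integral_dominated_convergence[where w = "\<lambda>\<omega>. K * w \<omega>"])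
    show "AE \<omega> in paths. (\<lambda>n. path_term (F n) l \<alpha> \<omega>) \<longlonglongrightarrow> path_term f l \<alpha> \<omega>"
      unfolding path_term_def by (intro AE_I2 tendsto_mult_right psi)
    show "AE \<omega> in paths. cmod (path_term (F n) l \<alpha> \<omega>) \<le> K * w \<omega>" for n
      by (rule w(2)[OF F])
  qed (use w(1) path_term_measurable[OF F l] path_term_measurable[OF f l] in auto)
qed

lemma mean_level_tendsto:
  assumes "\<And>n. dominated K (F n)" "\<And>x. (\<lambda>n. F n x) \<longlonglongrightarrow> f x" "dominated K f" "\<bar>\<alpha>\<bar> < 1" "j \<le> N"
  shows "(\<lambda>n. mean_level (F n) j \<alpha>) \<longlonglongrightarrow> mean_level f j \<alpha>"
proof -
  have "(\<lambda>n. \<Sum>l\<leftarrow>L. mean_term (F n) l \<alpha>) \<longlonglongrightarrow> (\<Sum>l\<leftarrow>L. mean_term f l \<alpha>)"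
    if "\<And>l. l \<in> set L \<Longrightarrow> length l \<le> N" for L
    using that by (induction L) (auto intro!: tendsto_add mean_term_tendsto[OF assms(1-4)])
  from this[of "diff_level j"] assms(5) length_diff_level[of _ j] show ?thesis
    unfolding mean_level_def by force
qed

section \<open>Remainder estimates uniform over the unit ball\<close>

lemma mean_level_uniformly_continuous:
  assumes \<alpha>: "\<bar>\<alpha>\<bar> < 1" and j: "j \<le> N" and e: "0 < e"
  shows "\<forall>\<^sub>F t in at \<alpha>. \<forall>f. dominated 1 f \<longrightarrow> cmod (mean_level f j t - mean_level f j \<alpha>) \<le> e"
proof -
  obtain g where g: "(g \<longlongrightarrow> 0) (at \<alpha>)" "\<forall>\<^sub>F t in at \<alpha>. \<forall>K f. dominated K f \<longrightarrow>
      cmod (mean_level f j t - mean_level f j \<alpha>) \<le> K * g t"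
    using mean_level_continuous[OF \<alpha> j] by blast
  from order_tendstoD(2)[OF g(1) e] g(2) show ?thesis
    by eventually_elim force
qed

text \<open>A full interval inside \<open>(-1, 1)\<close>, with \<open>t = \<alpha>\<close>
  included, because the mean value and Taylor arguments evaluate at intermediate points;
  \<open>d\<close> is chosen before \<open>f\<close>.\<close>

lemma mean_level_near:
  assumes \<alpha>: "\<bar>\<alpha>\<bar> < 1" and j: "j \<le> N" and e: "0 < e"
  obtains d where "0 < d" "\<And>t. \<bar>t - \<alpha>\<bar> < d \<Longrightarrow> \<bar>t\<bar> < 1"
    "\<And>t f. \<bar>t - \<alpha>\<bar> < d \<Longrightarrow> dominated 1 f \<Longrightarrow> cmod (mean_level f j t - mean_level f j \<alpha>) \<le> e"
proof -
  obtain d where d: "0 < d" "\<And>t f. t \<noteq> \<alpha> \<Longrightarrow> \<bar>t - \<alpha>\<bar> < d \<Longrightarrow> dominated 1 f \<Longrightarrow>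
      cmod (mean_level f j t - mean_level f j \<alpha>) \<le> e"
    using mean_level_uniformly_continuous[OF assms] by (auto simp: eventually_at dist_real_def)
  show thesis
  proof (rule that[of "min d (1 - \<bar>\<alpha>\<bar>)"])
    show "cmod (mean_level f j t - mean_level f j \<alpha>) \<le> e"
      if "\<bar>t - \<alpha>\<bar> < min d (1 - \<bar>\<alpha>\<bar>)" "dominated 1 f" for t f
      using d(2)[of t f] that e by (cases "t = \<alpha>") auto
  qed (use d(1) \<alpha> in auto)
qed

text \<open>The linearization error is at most \<open>|t - \<alpha>|\<close> times the oscillation
  of the derivative of order \<open>Suc j\<close> near \<open>\<alpha>\<close>, which is small
  uniformly in \<open>f\<close> by \<open>mean_level_near\<close>.\<close>

lemma mean_level_uniformly_differentiable:
  assumes \<alpha>: "\<bar>\<alpha>\<bar> < 1" and j: "j < N" and e: "0 < e"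
  shows "\<forall>\<^sub>F t in at \<alpha>. \<forall>f. dominated 1 f \<longrightarrow>
    cmod ((mean_level f j t - mean_level f j \<alpha>) / complex_of_real (t - \<alpha>) - mean_level f (Suc j) \<alpha>) \<le> e"
proof -
  obtain d where d: "0 < d" "\<And>t. \<bar>t - \<alpha>\<bar> < d \<Longrightarrow> \<bar>t\<bar> < 1"
    "\<And>t f. \<bar>t - \<alpha>\<bar> < d \<Longrightarrow> dominated 1 f \<Longrightarrow> cmod (mean_level f (Suc j) t - mean_level f (Suc j) \<alpha>) \<le> e"
    using mean_level_near[OF \<alpha> _ e, of "Suc j"] j by (metis Suc_leI)
  have "\<forall>\<^sub>F t in at \<alpha>. \<bar>t - \<alpha>\<bar> < d \<and> t \<noteq> \<alpha>"
    using d(1) by (auto simp: eventually_at dist_real_def)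
  then show ?thesis
  proof eventually_elim
    case (elim t)
    show ?case
    proof (intro allI impI)
      fix f assume f: "dominated 1 f"
      have "norm (mean_level f j t - mean_level f j \<alpha> - (t - \<alpha>) *\<^sub>R mean_level f (Suc j) \<alpha>) \<le> norm (t - \<alpha>) * e"
      proof (rule vector_differentiable_bound_linearization[where S = "ball \<alpha> d"])
        show "(mean_level f j has_vector_derivative mean_level f (Suc j) x) (at x within ball \<alpha> d)"
          if "x \<in> ball \<alpha> d" for x
          using mean_level_has_derivative[OF f d(2) j, of x] that
          by (auto simp: dist_real_def abs_minus_commute intro: has_vector_derivative_at_within)
        show "closed_segment \<alpha> t \<subseteq> ball \<alpha> d"
          using elim d(1) by (auto simp: closed_segment_eq_real_ivl dist_real_def split: if_splits)
        show "norm (mean_level f (Suc j) x - mean_level f (Suc j) \<alpha>) \<le> e" if "x \<in> ball \<alpha> d" for x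
          using d(3)[OF _ f] that by (auto simp: dist_real_def abs_minus_commute)
      qed (use d(1) in simp)
      moreover have "(mean_level f j t - mean_level f j \<alpha>) / complex_of_real (t - \<alpha>) - mean_level f (Suc j) \<alpha> =
          (mean_level f j t - mean_level f j \<alpha> - (t - \<alpha>) *\<^sub>R mean_level f (Suc j) \<alpha>) / complex_of_real (t - \<alpha>)"
      proof -
        have "complex_of_real (t - \<alpha>) \<noteq> 0" using elim by (simp only: of_real_eq_0_iff) simp
        then show ?thesis by (simp only: diff_divide_distrib scaleR_conv_of_real) simp
      qed
      ultimately show "cmod ((mean_level f j t - mean_level f j \<alpha>) / complex_of_real (t - \<alpha>) - mean_level f (Suc j) \<alpha>) \<le> e"
        using elim by (simp add: norm_divide divide_le_eq mult.commute del: of_real_diff)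
    qed
  qed
qed

text \<open>Lagrange's remainder contains the derivative of order \<open>N\<close> at a point
  \<open>s\<close> that depends on \<open>f\<close>; the radius \<open>d\<close> does not, so
  replacing \<open>s\<close> by \<open>\<alpha>\<close> costs at most \<open>e\<close> uniformly.
  Real parts are taken because the intermediate point exists for real functions.\<close>

lemma mean_level_taylor:
  assumes \<alpha>: "\<bar>\<alpha>\<bar> < 1" and e: "0 < e"
  shows "\<forall>\<^sub>F t in at \<alpha>. \<bar>t\<bar> < 1 \<and> (\<forall>f. dominated 1 f \<longrightarrow>
    \<bar>Re (mean_level f 0 t) - (\<Sum>j\<le>N. (t - \<alpha>) ^ j / fact j * Re (mean_level f j \<alpha>))\<bar> \<le> e * \<bar>t - \<alpha>\<bar> ^ N)"
proof -
  obtain d where d: "0 < d" "\<And>t. \<bar>t - \<alpha>\<bar> < d \<Longrightarrow> \<bar>t\<bar> < 1"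
    "\<And>t f. \<bar>t - \<alpha>\<bar> < d \<Longrightarrow> dominated 1 f \<Longrightarrow> cmod (mean_level f N t - mean_level f N \<alpha>) \<le> e"
    using mean_level_near[OF \<alpha> order_refl e] by metis
  have "\<forall>\<^sub>F t in at \<alpha>. \<bar>t - \<alpha>\<bar> < d \<and> t \<noteq> \<alpha>"
    using d(1) by (auto simp: eventually_at dist_real_def)
  then show ?thesis
  proof eventually_elim
    case (elim t)
    show ?case
    proof (intro conjI allI impI)
      show "\<bar>t\<bar> < 1" using elim d(2) by simp
      fix f assume f: "dominated 1 f"
      let ?g = "\<lambda>j t. Re (mean_level f j t)"
      have "\<exists>s. (if t < \<alpha> then t < s \<and> s < \<alpha> else \<alpha> < s \<and> s < t) \<and>
        ?g 0 t = (\<Sum>m<N. ?g m \<alpha> / fact m * (t - \<alpha>) ^ m) + ?g N s / fact N * (t - \<alpha>) ^ N"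
      proof (rule Taylor[where a = "min \<alpha> t" and b = "max \<alpha> t"])
        show "\<forall>m s. m < N \<and> min \<alpha> t \<le> s \<and> s \<le> max \<alpha> t \<longrightarrow> (?g m has_real_derivative ?g (Suc m) s) (at s)"
        proof (intro allI impI)
          fix m s assume m: "m < N \<and> min \<alpha> t \<le> s \<and> s \<le> max \<alpha> t"
          then have "\<bar>s - \<alpha>\<bar> < d" using elim by auto
          from mean_level_has_derivative[OF f d(2)[OF this], of m] m
          have "(mean_level f m has_vector_derivative mean_level f (Suc m) s) (at s)" by simp
          then show "(?g m has_real_derivative ?g (Suc m) s) (at s)"
            unfolding has_real_derivative_iff_has_vector_derivative
            by (rule bounded_linear.has_vector_derivative[OF bounded_linear_Re])
        qed
      qed (use N_pos elim in auto)
      then obtain s where s: "if t < \<alpha> then t < s \<and> s < \<alpha> else \<alpha> < s \<and> s < t"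
        "?g 0 t = (\<Sum>m<N. ?g m \<alpha> / fact m * (t - \<alpha>) ^ m) + ?g N s / fact N * (t - \<alpha>) ^ N"
        by blast
      have "\<bar>s - \<alpha>\<bar> < d" using s(1) elim by (auto split: if_splits)
      then have "\<bar>?g N s - ?g N \<alpha>\<bar> \<le> e"
        using d(3)[OF _ f, of s] abs_Re_le_cmod[of "mean_level f N s - mean_level f N \<alpha>"] by simp
      have "?g 0 t - (\<Sum>j\<le>N. (t - \<alpha>) ^ j / fact j * ?g j \<alpha>) = (?g N s - ?g N \<alpha>) / fact N * (t - \<alpha>) ^ N"
        unfolding s(2) by (simp add: lessThan_Suc_atMost[symmetric] algebra_simps diff_divide_distrib)
      also have "\<bar>\<dots>\<bar> = \<bar>?g N s - ?g N \<alpha>\<bar> / fact N * \<bar>t - \<alpha>\<bar> ^ N"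
        by (simp add: abs_mult power_abs)
      also have "\<dots> \<le> e * \<bar>t - \<alpha>\<bar> ^ N"
      proof (rule mult_right_mono)
        have "\<bar>?g N s - ?g N \<alpha>\<bar> / fact N \<le> \<bar>?g N s - ?g N \<alpha>\<bar> / 1"
          by (intro divide_left_mono) (simp_all add: fact_ge_1)
        then show "\<bar>?g N s - ?g N \<alpha>\<bar> / fact N \<le> e" using \<open>\<bar>?g N s - ?g N \<alpha>\<bar> \<le> e\<close> by simp
      qed simp
      finally show "\<bar>?g 0 t - (\<Sum>j\<le>N. (t - \<alpha>) ^ j / fact j * ?g j \<alpha>)\<bar> \<le> e * \<bar>t - \<alpha>\<bar> ^ N" .
    qed
  qed
qed

text \<open>The newest noise \<open>s\<close> is separated from the past and integrated first; this
  turns \<open>f\<close> into \<open>psi f 0\<close>, evaluated at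
  \<open>drift 0 \<alpha> \<omega>\<close> for almost every path.\<close>

lemma invariant_integral:
  assumes \<alpha>: "\<bar>\<alpha>\<bar> < 1" and inv: "ar_invariant \<nu> \<alpha> \<pi>" and f: "dominated K f"
  shows "(\<integral>x. f x \<partial>\<pi>) = mean_level f 0 \<alpha>"
proof -
  obtain a b where ab: "\<bar>\<alpha>\<bar> < a" "0 \<le> a" "a < b" "0 < b" "b < 1" using between[OF \<alpha>] .
  have \<alpha>b: "\<bar>\<alpha>\<bar> < b" using ab by simp
  note [measurable] = dominated_measurable[OF f]
  have drift0: "AE \<omega> in paths. drift 0 \<alpha> \<omega> = \<alpha> * path_sum \<alpha> \<omega>"
    using AE_good[OF ab(4,5)] by eventually_elim (rule path_sum_case_nat(2)[OF r_ge_1 ab(4,5) _ \<alpha>b])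
  let ?h = "\<lambda>\<omega>. (1 + \<bar>\<alpha> * path_sum \<alpha> \<omega>\<bar>) powr \<delta>"
  have h: "integrable paths ?h"
  proof -
    obtain P where P: "0 \<le> P" "\<And>\<omega> \<alpha>. summable (\<lambda>k. b ^ k * \<bar>\<omega> k\<bar> powr r) \<Longrightarrow> \<bar>\<alpha>\<bar> \<le> a \<Longrightarrow>
        \<bar>drift 0 \<alpha> \<omega>\<bar> \<le> P * path_bound r b \<omega>"
      using drift_bound[OF ab(2,3,5) r_ge_1, of 0] by blast
    show ?thesis
    proof (rule Bochner_Integration.integrable_bound)
      show "integrable paths (\<lambda>\<omega>. (2 * (P + 1)) powr \<delta> * (1 + path_moment r b \<omega>))"
        by (rule integrable_path_moment_mult[OF ab(4,5)])
      show "AE \<omega> in paths. norm (?h \<omega>) \<le> norm ((2 * (P + 1)) powr \<delta> * (1 + path_moment r b \<omega>))"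
        using AE_good[OF ab(4,5)] drift0
      proof eventually_elim
        case (elim \<omega>)
        have "\<bar>drift 0 \<alpha> \<omega>\<bar> \<le> P * path_bound r b \<omega>" using P(2)[OF elim(1)] ab by simp
        also have "\<dots> \<le> (P + 1) * path_bound r b \<omega>"
          using path_bound_ge_1[OF r_ge_1 ab(4,5) elim(1)] by (intro mult_right_mono) auto
        finally have "\<bar>drift 0 \<alpha> \<omega>\<bar> \<le> (P + 1) * path_bound r b \<omega>" .
        from moment_bound[OF _ ab(4,5) elim(1) this, of 0] P(1) elim(2)
        have "?h \<omega> \<le> (2 * (P + 1)) powr \<delta> * (1 + path_moment r b \<omega>)" by simp
        then show ?case by simp
      qed
    qed measurable
  qed
  have g: "integrable noise (\<lambda>s. K * (1 + \<bar>s\<bar>) powr \<delta>)"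
    using integrable_weight_density by (subst integrable_noise) (auto simp: mult_ac)
  \<comment> \<open>Submultiplicativity of the weight gives a product majorant, one factor in the
    newest noise and one in the past, which justifies Fubini.\<close>
  have int: "integrable (noise \<Otimes>\<^sub>M paths) (\<lambda>(s, \<omega>). f (s + \<alpha> * path_sum \<alpha> \<omega>))"
  proof (rule Bochner_Integration.integrable_bound[OF integrable_pair_mult[OF _ g h]])
    show "pair_sigma_finite noise paths" by unfold_locales
    show "AE x in noise \<Otimes>\<^sub>M paths. cmod (case x of (s, \<omega>) \<Rightarrow> f (s + \<alpha> * path_sum \<alpha> \<omega>)) \<le>
        norm (case x of (s, \<omega>) \<Rightarrow> K * (1 + \<bar>s\<bar>) powr \<delta> * ?h \<omega>)"
    proof (rule AE_I2)
      fix x :: "real \<times> (nat \<Rightarrow> real)"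
      obtain s \<omega> where x: "x = (s, \<omega>)" by (cases x)
      have "cmod (f (s + \<alpha> * path_sum \<alpha> \<omega>)) \<le> K * (1 + \<bar>s + \<alpha> * path_sum \<alpha> \<omega>\<bar>) powr \<delta>"
        using f by (simp add: dominated_def)
      also have "\<dots> \<le> K * ((1 + \<bar>s\<bar>) powr \<delta> * ?h \<omega>)"
        using powr_one_plus_abs_add[of \<delta> s "\<alpha> * path_sum \<alpha> \<omega>"] \<delta>_bounds dominated_nonneg[OF f]
        by (intro mult_left_mono) auto
      finally show "cmod (case x of (s, \<omega>) \<Rightarrow> f (s + \<alpha> * path_sum \<alpha> \<omega>)) \<le>
          norm (case x of (s, \<omega>) \<Rightarrow> K * (1 + \<bar>s\<bar>) powr \<delta> * ?h \<omega>)"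
        using dominated_nonneg[OF f] by (simp add: x mult.assoc)
    qed
  qed measurable
  have "(\<integral>x. f x \<partial>\<pi>) = (\<integral>x. f x \<partial>distr (noise \<Otimes>\<^sub>M paths) borel (\<lambda>(s, \<omega>). s + \<alpha> * path_sum \<alpha> \<omega>))"
    using invariant_eq_distr_path_sum[OF \<alpha> inv] distr_path_sum[OF \<alpha>] by simp
  also have "\<dots> = (\<integral>x. f (case x of (s, \<omega>) \<Rightarrow> s + \<alpha> * path_sum \<alpha> \<omega>) \<partial>(noise \<Otimes>\<^sub>M paths))"
    by (rule integral_distr) measurable
  also have "\<dots> = (\<integral>\<omega>. (\<integral>s. f (s + \<alpha> * path_sum \<alpha> \<omega>) \<partial>noise) \<partial>paths)"
    using noise_paths.integral_snd[of "\<lambda>s \<omega>. f (s + \<alpha> * path_sum \<alpha> \<omega>)"] int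
    by (simp add: split_beta')
  also have "\<dots> = (\<integral>\<omega>. psi f 0 (\<alpha> * path_sum \<alpha> \<omega>) \<partial>paths)"
  proof (intro Bochner_Integration.integral_cong refl)
    fix \<omega>
    let ?v = "\<alpha> * path_sum \<alpha> \<omega>"
    have "(\<integral>s. f (s + ?v) \<partial>noise) = (\<integral>s. \<nu> s *\<^sub>R f (s + ?v) \<partial>lborel)"
      by (rule integral_noise) measurable
    also have "\<dots> = psi f 0 ?v"
      using lborel_integral_real_affine[of 1 "\<lambda>y. f y * complex_of_real (\<nu> (y - ?v))" ?v]
      by (simp add: psi_def scaleR_conv_of_real add.commute mult.commute)
    finally show "(\<integral>s. f (s + ?v) \<partial>noise) = psi f 0 ?v" .
  qed
  also have "\<dots> = (\<integral>\<omega>. path_term f [] \<alpha> \<omega> \<partial>paths)"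
  proof (rule integral_cong_AE)
    note psi_measurable[OF f, of 0, measurable]
    show "(\<lambda>\<omega>. psi f 0 (\<alpha> * path_sum \<alpha> \<omega>)) \<in> borel_measurable paths" by measurable
    show "path_term f [] \<alpha> \<in> borel_measurable paths" by (rule path_term_measurable[OF f]) simp
    show "AE \<omega> in paths. psi f 0 (\<alpha> * path_sum \<alpha> \<omega>) = path_term f [] \<alpha> \<omega>"
      using drift0 by eventually_elim (simp add: path_term_def drift_prod_def)
  qed
  finally show ?thesis by (simp add: mean_level_def mean_term_def)
qed

lemma mean_level_wdual:
  assumes "\<bar>\<alpha>\<bar> < 1" "j \<le> N"
  shows "(\<lambda>f. mean_level f j \<alpha>) \<in> wdual r \<beta>"
proof -
  obtain B where "\<And>K f. dominated K f \<Longrightarrow> cmod (mean_level f j \<alpha>) \<le> B * K"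
    using mean_level_bound[OF assms] by blast
  then have "\<exists>B. \<forall>f\<in>wspace r \<beta>. cmod (mean_level f j \<alpha>) \<le> B * wnorm r \<beta> f"
    using wspace_dominated by blast
  then show ?thesis
    using mean_level_add[OF wspace_dominated wspace_dominated assms] by (auto simp: wdual_def mean_level_mult)
qed

lemma dominated_indicator: "B \<in> sets borel \<Longrightarrow> dominated 1 (\<lambda>x. complex_of_real (indicator B x))"
  by (rule dominated_one) (auto simp: indicator_def)

text \<open>Finite additivity is linearity in the indicator; countable additivity is bounded
  convergence along the finite unions.\<close>

lemma signed_measure_mean_level:
  assumes \<alpha>: "\<bar>\<alpha>\<bar> < 1" and j: "j \<le> N"
  shows "signed_measure borel (\<lambda>B. Re (mean_level (\<lambda>x. complex_of_real (indicator B x)) j \<alpha>))"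
  unfolding signed_measure_def
proof (intro conjI allI impI)
  let ?m = "\<lambda>B. mean_level (\<lambda>x. complex_of_real (indicator B x)) j \<alpha>"
  show empty: "Re (?m {}) = 0"
    using mean_level_mult[of 0 "\<lambda>_. 0" j \<alpha>] by simp
  fix B :: "nat \<Rightarrow> real set" assume B: "range B \<subseteq> sets borel \<and> disjoint_family B"
  have [measurable]: "B n \<in> sets borel" for n using B by auto
  have sum: "(\<Sum>i<n. Re (?m (B i))) = Re (?m (\<Union>i<n. B i))" for n
  proof (induction n)
    case 0
    then show ?case using empty by simp
  next
    case (Suc n)
    have "(\<Union>i<n. B i) \<inter> B n = {}"
    proof -
      have "B i \<inter> B n = {}" if "i < n" for i
        using B that disjoint_family_onD[of B UNIV i n] by simp
      then show ?thesis by blast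
    qed
    then have "indicator (\<Union>i<Suc n. B i) x = (indicator (\<Union>i<n. B i) x + indicator (B n) x :: real)" for x
      by (auto simp: indicator_def lessThan_Suc)
    then have "?m (\<Union>i<Suc n. B i) = ?m (\<Union>i<n. B i) + ?m (B n)"
      using mean_level_add[OF dominated_indicator dominated_indicator \<alpha> j, of "\<Union>i<n. B i" "B n"] by simp
    then show ?case using Suc by simp
  qed
  have "(\<lambda>n. ?m (\<Union>i<n. B i)) \<longlonglongrightarrow> ?m (\<Union>i. B i)"
  proof (rule mean_level_tendsto[where K = 1, OF _ _ _ \<alpha> j])
    show "(\<lambda>n. complex_of_real (indicator (\<Union>i<n. B i) x)) \<longlonglongrightarrow> complex_of_real (indicator (\<Union>i. B i) x)" for x
      by (intro tendsto_of_real LIMSEQ_indicator_UN)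
  qed (rule dominated_indicator, measurable)+
  from tendsto_Re[OF this] show "(\<lambda>i. Re (?m (B i))) sums Re (?m (\<Union>i. B i))"
    by (simp add: sums_def sum)
qed

section \<open>Conclusions for a family of invariant measures\<close>

context
  fixes \<pi> :: "real \<Rightarrow> real measure"
  assumes invariant: "\<And>\<alpha>. \<alpha> \<in> {-1<..<1} \<Longrightarrow> ar_invariant \<nu> \<alpha> (\<pi> \<alpha>)"
begin

lemma invariant_mean_level:
  assumes "\<bar>\<alpha>\<bar> < 1" "dominated K f"
  shows "(\<integral>x. f x \<partial>\<pi> \<alpha>) = mean_level f 0 \<alpha>"
  using assms by (intro invariant_integral invariant) auto

lemma invariant_Ck: "wdual_Ck r \<beta> N {-1<..<1} (\<lambda>\<alpha> f. \<integral>x. f x \<partial>\<pi> \<alpha>)"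
proof -
  \<comment> \<open>\<open>wdual_Ck\<close> demands \<open>G 0 = F\<close> for all arguments, also
    for \<open>f\<close> outside the space and \<open>\<alpha>\<close> outside the interval, where
    \<open>mean_level f 0 \<alpha>\<close> need not be the integral; hence the case
    distinction.\<close>
  define G where "G j \<alpha> f = (if j = 0 then \<integral>x. f x \<partial>\<pi> \<alpha> else mean_level f j \<alpha>)" for j :: nat and \<alpha> f
  have G: "G j \<alpha> f = mean_level f j \<alpha>" if "\<bar>\<alpha>\<bar> < 1" "dominated K f" for j \<alpha> f K
    using invariant_mean_level[OF that] by (simp add: G_def)
  have unit: "dominated 1 f" if "f \<in> wspace r \<beta>" "wnorm r \<beta> f \<le> 1" for f
    using dominated_mono[OF wspace_dominated] that by blast
  have near: "\<forall>\<^sub>F t in at \<alpha>. \<bar>t\<bar> < 1" if "\<bar>\<alpha>\<bar> < 1" for \<alpha> :: real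
    using that by (auto simp: eventually_at dist_real_def intro!: exI[of _ "1 - \<bar>\<alpha>\<bar>"])
  have dual: "G j \<alpha> \<in> wdual r \<beta>" if j: "j \<le> N" and \<alpha>: "\<bar>\<alpha>\<bar> < 1" for j \<alpha>
  proof -
    have eq: "G j \<alpha> f = mean_level f j \<alpha>" if "f \<in> wspace r \<beta>" for f
      by (rule G[OF \<alpha> wspace_dominated[OF that]])
    have add: "G j \<alpha> (\<lambda>x. f x + g x) = mean_level (\<lambda>x. f x + g x) j \<alpha>"
      if "f \<in> wspace r \<beta>" "g \<in> wspace r \<beta>" for f g
      by (rule G[OF \<alpha> dominated_add[OF wspace_dominated[OF that(1)] wspace_dominated[OF that(2)]]])
    have mult: "G j \<alpha> (\<lambda>x. c * f x) = mean_level (\<lambda>x. c * f x) j \<alpha>" if "f \<in> wspace r \<beta>" for c f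
      by (rule G[OF \<alpha> dominated_mult[OF wspace_dominated[OF that]]])
    show ?thesis
      using mean_level_wdual[OF \<alpha> j] unfolding wdual_def by (simp add: eq add mult)
  qed
  have deriv: "wdual_has_derivative_at r \<beta> (G j) (G (Suc j) \<alpha>) \<alpha>" if j: "j < N" and \<alpha>: "\<bar>\<alpha>\<bar> < 1" for j \<alpha>
    unfolding wdual_has_derivative_at_def
  proof (rule wdual_norm_tendsto_0)
    fix e :: real assume e: "0 < e"
    have "\<forall>\<^sub>F t in at \<alpha>. \<forall>f. f \<in> wspace r \<beta> \<longrightarrow> wnorm r \<beta> f \<le> 1 \<longrightarrow>
        cmod ((G j t f - G j \<alpha> f) / complex_of_real (t - \<alpha>) - G (Suc j) \<alpha> f) \<le> e"
      using near[OF \<alpha>] mean_level_uniformly_differentiable[OF \<alpha> j e]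
      by eventually_elim (use G[OF _ unit] \<alpha> unit in simp)
    then show "\<forall>\<^sub>F h in at 0. \<forall>f. f \<in> wspace r \<beta> \<longrightarrow> wnorm r \<beta> f \<le> 1 \<longrightarrow>
        cmod ((G j (\<alpha> + h) f - G j \<alpha> f) / complex_of_real h - G (Suc j) \<alpha> f) \<le> e"
      by (subst (asm) eventually_at_to_0) (simp add: add.commute)
  qed
  have cont: "wdual_continuous_at r \<beta> (G N) \<alpha>" if \<alpha>: "\<bar>\<alpha>\<bar> < 1" for \<alpha>
    unfolding wdual_continuous_at_def
  proof (rule wdual_norm_tendsto_0)
    fix e :: real assume e: "0 < e"
    have "\<forall>\<^sub>F t in at \<alpha>. \<forall>f. f \<in> wspace r \<beta> \<longrightarrow> wnorm r \<beta> f \<le> 1 \<longrightarrow> cmod (G N t f - G N \<alpha> f) \<le> e"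
      using near[OF \<alpha>] mean_level_uniformly_continuous[OF \<alpha> order_refl e]
      by eventually_elim (use G[OF _ unit] \<alpha> unit in simp)
    then show "\<forall>\<^sub>F h in at 0. \<forall>f. f \<in> wspace r \<beta> \<longrightarrow> wnorm r \<beta> f \<le> 1 \<longrightarrow>
        cmod (G N (\<alpha> + h) f - G N \<alpha> f) \<le> e"
      by (subst (asm) eventually_at_to_0) (simp add: add.commute)
  qed
  show ?thesis
    unfolding wdual_Ck_def
    using dual deriv cont by (intro exI[of _ G]) (auto simp: G_def[of 0] fun_eq_iff abs_less_iff)
qed

lemma invariant_expansion:
  assumes \<alpha>: "\<alpha> \<in> {-1<..<1}"
  shows "\<exists>(\<mu> :: nat \<Rightarrow> real set \<Rightarrow> real) (R :: real \<Rightarrow> real set \<Rightarrow> real).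
    (\<forall>j\<in>{1..N}. signed_measure borel (\<mu> j)) \<and>
    (\<forall>\<epsilon>. \<alpha> + \<epsilon> \<in> {-1<..<1} \<longrightarrow>
       (\<forall>A\<in>sets borel.
          measure (\<pi> (\<alpha> + \<epsilon>)) A =
            measure (\<pi> \<alpha>) A + (\<Sum>j = 1..N. \<epsilon> ^ j / fact j * \<mu> j A) + \<epsilon> ^ N * R \<epsilon> A)) \<and>
    ((\<lambda>\<epsilon>. SUP A\<in>sets borel. ereal \<bar>R \<epsilon> A\<bar>) \<longlongrightarrow> 0) (at 0)"
proof -
  have \<alpha>1: "\<bar>\<alpha>\<bar> < 1" using \<alpha> by auto
  let ?m = "\<lambda>j t B. Re (mean_level (\<lambda>x. complex_of_real (indicator B x)) j t)"
  have measure_eq: "measure (\<pi> t) B = ?m 0 t B" if t: "\<bar>t\<bar> < 1" and B: "B \<in> sets borel" for t B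
  proof -
    have inv: "ar_invariant \<nu> t (\<pi> t)" using t by (intro invariant) auto
    then have s: "sets (\<pi> t) = sets borel" and "prob_space (\<pi> t)" by (auto simp: ar_invariant_def)
    interpret prob_space "\<pi> t" by fact
    have "mean_level (\<lambda>x. complex_of_real (indicator B x)) 0 t = (\<integral>x. complex_of_real (indicator B x) \<partial>\<pi> t)"
      using invariant_mean_level[OF t dominated_indicator[OF B]] by simp
    also have "\<dots> = complex_of_real (\<integral>x. indicator B x \<partial>\<pi> t)" by (rule integral_complex_of_real)
    also have "(\<integral>x. indicator B x \<partial>\<pi> t) = measure (\<pi> t) B" using B s by simp
    finally show ?thesis by simp
  qed
  \<comment> \<open>Solved from the expansion. At \<open>\<epsilon> = 0\<close> division by zero
    gives the value 0; all powers then vanish, their exponents being at least 1, and the expansion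
    remains true.\<close>
  define R where "R \<epsilon> B = (measure (\<pi> (\<alpha> + \<epsilon>)) B - measure (\<pi> \<alpha>) B -
      (\<Sum>j = 1..N. \<epsilon> ^ j / fact j * ?m j \<alpha> B)) / \<epsilon> ^ N" for \<epsilon> B
  show ?thesis
  proof (intro exI[of _ "\<lambda>j. ?m j \<alpha>"] exI[of _ R] conjI ballI allI impI)
    show "signed_measure borel (?m j \<alpha>)" if "j \<in> {1..N}" for j
      using that by (intro signed_measure_mean_level[OF \<alpha>1]) simp
    fix \<epsilon> B
    show "measure (\<pi> (\<alpha> + \<epsilon>)) B =
        measure (\<pi> \<alpha>) B + (\<Sum>j = 1..N. \<epsilon> ^ j / fact j * ?m j \<alpha> B) + \<epsilon> ^ N * R \<epsilon> B"
    proof (cases "\<epsilon> = 0")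
      case True
      then show ?thesis using N_pos by (simp add: power_0_left)
    qed (simp add: R_def)
  next
    show "((\<lambda>\<epsilon>. SUP A\<in>sets borel. ereal \<bar>R \<epsilon> A\<bar>) \<longlongrightarrow> 0) (at 0)"
    proof (rule tendsto_SUP_ereal_0)
      fix e :: real assume "0 < e"
      from mean_level_taylor[OF \<alpha>1 this]
      have "\<forall>\<^sub>F t in at \<alpha>. \<forall>B\<in>sets borel. \<bar>R (t - \<alpha>) B\<bar> \<le> e"
        using eventually_neq_at_within[of \<alpha>]
      proof eventually_elim
        case (elim t)
        show ?case
        proof
          fix B :: "real set" assume B: "B \<in> sets borel"
          \<comment> \<open>The term \<open>j = 0\<close> of the Taylor sum is the measure of
            \<open>B\<close> under \<open>\<pi> \<alpha>\<close>.\<close>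
          have "(\<Sum>j\<le>N. (t - \<alpha>) ^ j / fact j * ?m j \<alpha> B) =
              ?m 0 \<alpha> B + (\<Sum>j = 1..N. (t - \<alpha>) ^ j / fact j * ?m j \<alpha> B)"
            by (simp add: atMost_atLeast0 sum.atLeast_Suc_atMost)
          then have "R (t - \<alpha>) B =
              (?m 0 t B - (\<Sum>j\<le>N. (t - \<alpha>) ^ j / fact j * ?m j \<alpha> B)) / (t - \<alpha>) ^ N"
            using elim(1) measure_eq[OF \<alpha>1 B] measure_eq[of t B] B by (simp add: R_def)
          moreover have "\<bar>?m 0 t B - (\<Sum>j\<le>N. (t - \<alpha>) ^ j / fact j * ?m j \<alpha> B)\<bar> \<le> e * \<bar>t - \<alpha>\<bar> ^ N"
            using elim(1) dominated_indicator[OF B] by blast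
          ultimately show "\<bar>R (t - \<alpha>) B\<bar> \<le> e"
            using elim(2) by (simp add: abs_divide power_abs divide_le_eq)
        qed
      qed
      then show "\<forall>\<^sub>F \<epsilon> in at 0. \<forall>B\<in>sets borel. \<bar>R \<epsilon> B\<bar> \<le> e"
        by (subst (asm) eventually_at_to_0) simp
    qed blast
  qed
qed

end

end

theorem proposition1:
  fixes r :: real
  assumes r_ge_1: "1 \<le> r"
    and r_nonint: "r \<notin> \<int>"
  shows "\<exists>\<beta>. 0 < \<beta> \<and> \<beta> < 1 \<and>
    (\<forall>(\<nu> :: real \<Rightarrow> real) (\<pi> :: real \<Rightarrow> real measure).
       prob_density \<nu> \<and>
       integrable lborel (\<lambda>x. \<bar>x\<bar> powr r * \<nu> x) \<and>
       (\<forall>t. 0 < \<nu> t) \<and>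
       Ck_real (nat \<lfloor>r\<rfloor> + 1) \<nu> \<and>
       (\<forall>j\<in>{1..nat \<lfloor>r\<rfloor> + 1}. bdd_above (range (\<lambda>t. \<bar>(deriv ^^ j) \<nu> t\<bar> / \<nu> t))) \<and>
       (\<forall>x0. \<exists>U q. open U \<and> x0 \<in> U \<and> q \<in> borel_measurable borel \<and> (\<forall>y. 0 \<le> q y) \<and>
          integrable lborel (\<lambda>y. (1 + \<bar>y\<bar>) powr r * q y) \<and>
          (\<forall>y. \<forall>v\<in>U. \<nu> (y + v) \<le> q y)) \<and>
       (\<forall>\<alpha>\<in>{-1<..<1}. ar_invariant \<nu> \<alpha> (\<pi> \<alpha>))
       \<longrightarrow>
       wdual_Ck r \<beta> (nat \<lfloor>r\<rfloor>) {-1<..<1} (\<lambda>\<alpha> f. \<integral>x. f x \<partial>(\<pi> \<alpha>)) \<and>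
       (\<forall>\<alpha>\<in>{-1<..<1}. \<exists>(\<mu> :: nat \<Rightarrow> real set \<Rightarrow> real) (R :: real \<Rightarrow> real set \<Rightarrow> real).
          (\<forall>j\<in>{1..nat \<lfloor>r\<rfloor>}. signed_measure borel (\<mu> j)) \<and>
          (\<forall>\<epsilon>. \<alpha> + \<epsilon> \<in> {-1<..<1} \<longrightarrow>
             (\<forall>A\<in>sets borel.
                measure (\<pi> (\<alpha> + \<epsilon>)) A =
                  measure (\<pi> \<alpha>) A + (\<Sum>j = 1..nat \<lfloor>r\<rfloor>. \<epsilon> ^ j / fact j * \<mu> j A)
                    + \<epsilon> ^ nat \<lfloor>r\<rfloor> * R \<epsilon> A)) \<and>
          ((\<lambda>\<epsilon>. SUP A\<in>sets borel. ereal \<bar>R \<epsilon> A\<bar>) \<longlongrightarrow> 0) (at 0)))"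
proof -
  define N where "N = nat \<lfloor>r\<rfloor>"
  have N_floor: "real N = of_int \<lfloor>r\<rfloor>" using r_ge_1 by (simp add: N_def)
  \<comment> \<open>Non-integrality makes the integer part strictly smaller than \<open>r\<close>,
    so the exponent \<open>?\<beta>\<close> below is positive.\<close>
  have "real N \<noteq> r" using r_nonint by (metis Ints_of_nat)
  moreover have "real N \<le> r" "r < real N + 1" using floor_correct[of r] N_floor by linarith+
  moreover have "1 \<le> N" using r_ge_1 by (simp add: N_def le_nat_iff)
  ultimately have N: "1 \<le> N" "real N < r" "r < real N + 1" by auto
  let ?\<beta> = "(r - real N) / r"
  show ?thesis
    unfolding N_def[symmetric]
  proof (intro exI[of _ ?\<beta>] conjI[of "0 < ?\<beta>"] conjI[of "?\<beta> < 1"] allI impI)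
    show "0 < ?\<beta>" "?\<beta> < 1" using N r_ge_1 by auto
  next
    fix \<nu> :: "real \<Rightarrow> real" and \<pi> :: "real \<Rightarrow> real measure"
    assume *: "prob_density \<nu> \<and>
       integrable lborel (\<lambda>x. \<bar>x\<bar> powr r * \<nu> x) \<and>
       (\<forall>t. 0 < \<nu> t) \<and>
       Ck_real (N + 1) \<nu> \<and>
       (\<forall>j\<in>{1..N + 1}. bdd_above (range (\<lambda>t. \<bar>(deriv ^^ j) \<nu> t\<bar> / \<nu> t))) \<and>
       (\<forall>x0. \<exists>U q. open U \<and> x0 \<in> U \<and> q \<in> borel_measurable borel \<and> (\<forall>y. 0 \<le> q y) \<and>
          integrable lborel (\<lambda>y. (1 + \<bar>y\<bar>) powr r * q y) \<and>
          (\<forall>y. \<forall>v\<in>U. \<nu> (y + v) \<le> q y)) \<and>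
       (\<forall>\<alpha>\<in>{-1<..<1}. ar_invariant \<nu> \<alpha> (\<pi> \<alpha>))"
    interpret smooth_noise r N \<nu>
      using N * by unfold_locales auto
    have "\<beta> = ?\<beta>" by (simp add: \<beta>_def \<delta>_def)
    moreover have "ar_invariant \<nu> \<alpha> (\<pi> \<alpha>)" if "\<alpha> \<in> {-1<..<1}" for \<alpha>
      using * that by blast
    ultimately show "wdual_Ck r ?\<beta> N {-1<..<1} (\<lambda>\<alpha> f. \<integral>x. f x \<partial>(\<pi> \<alpha>)) \<and>
       (\<forall>\<alpha>\<in>{-1<..<1}. \<exists>(\<mu> :: nat \<Rightarrow> real set \<Rightarrow> real) (R :: real \<Rightarrow> real set \<Rightarrow> real).
          (\<forall>j\<in>{1..N}. signed_measure borel (\<mu> j)) \<and>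
          (\<forall>\<epsilon>. \<alpha> + \<epsilon> \<in> {-1<..<1} \<longrightarrow>
             (\<forall>A\<in>sets borel.
                measure (\<pi> (\<alpha> + \<epsilon>)) A =
                  measure (\<pi> \<alpha>) A + (\<Sum>j = 1..N. \<epsilon> ^ j / fact j * \<mu> j A)
                    + \<epsilon> ^ N * R \<epsilon> A)) \<and>
          ((\<lambda>\<epsilon>. SUP A\<in>sets borel. ereal \<bar>R \<epsilon> A\<bar>) \<longlongrightarrow> 0) (at 0))"
      using invariant_Ck[of \<pi>] invariant_expansion[of \<pi>] by simp
  qed
qed

end
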